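(* Let $\nu>0$, $k\ge2$, $f\in C^k(\mathbb{R};\mathbb{R})$, $\bar u\in C^k([0,1])$, and let $u$ be the unique classical solution, of class $C^k$, of the viscous scalar conservation law $$u_t+f(u)_x=\nu u_{xx}\ \ (x\in(0,1),\ t\in[0,T]),\qquad u(x,0)=\bar u(x)\ \ (x\in(0,1)),\qquad u(0,t)=u(1,t)=0\ \ (t\in[0,T]).$$ Let $u^{\ast}=u_{\theta^{\ast}}$ be the PINN generated by the PINN algorithm with the loss function given in the context. Then the generalization error $\mathcal{E}_G=\big(\int_0^T\int_0^1|u-u^{\ast}|^2dx\,dt\big)^{1/2}$ is bounded by $$\begin{aligned}\mathcal{E}_G^2\le{}&\big(T+\mathbf{C}T^2e^{\mathbf{C}T}\big)\Big[(\mathcal{E}_T^{tb})^2+(\mathcal{E}_T^{int})^2+2\bar{\mathbf{C}}_b\big((\mathcal{E}_T^{sb,0})^2+(\mathcal{E}_T^{sb,1})^2\big)+2\nu\mathbf{C}_bT^{\frac12}\big(\mathcal{E}_T^{sb,0}+\mathcal{E}_T^{sb,1}\big)\Big]\\&+\big(T+\mathbf{C}T^2e^{\mathbf{C}T}\big)\Big[C_{quad}^{tb}N_{tb}^{-\alpha_{tb}}+C_{quad}^{int}N_{int}^{-\alpha_{int}}+2\bar{\mathbf{C}}_b\big(C_{quad}^{sb,0}+C_{quad}^{sb,1}\big)N_{sb}^{-\alpha_{sb}}\\&\qquad\qquad+2\nu\mathbf{C}_bT^{\frac12}\big(C_{quad}^{sb,0}+C_{quad}^{sb,1}\big)^{\frac12}N_{sb}^{-\frac{\alpha_{sb}}2}\Big].\end{aligned}$$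 Here $\mathbf{C}=1+2C_{f,u,u^{\ast}}$ with $$C_{f,u,u^{\ast}}=\Big(\max_{|s|\le\max\{\|u\|_{L^\infty},\|u^{\ast}\|_{L^\infty}\}}|f''(s)|\Big)\|u_x\|_{L^\infty},\qquad\mathbf{C}_b=\|u_x\|_{C([0,1]\times[0,T])}+\|u_x^{\ast}\|_{C([0,1]\times[0,T])},$$ $\bar{\mathbf{C}}_b=\bar{\mathbf{C}}_b\big(\|f'\|_\infty,\|u^{\ast}\|_{C^0([0,1]\times[0,T])}\big)$ is a constant depending only on the indicated quantities, and $C_{quad}^{tb}=C_{quad}^{tb}(\|\mathcal{R}_{tb,\theta^{\ast}}^2\|_{C^k})$, $C_{quad}^{int}=C_{quad}^{int}(\|\mathcal{R}_{int,\theta^{\ast}}^2\|_{C^{k-2}})$, $C_{quad}^{sb,i}=C_{quad}^{sb}(\|\mathcal{R}_{sb,i,\theta^{\ast}}^2\|_{C^k})$ for $i=0,1$ are the constants of the quadrature error bounds in the context.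
   Context: The solution satisfies $u\in C^k([0,T)\times[0,1])$, and the norms of $u$ and $u_x$ over $[0,1]\times[0,T]$ appearing in the constants are finite. The quantity $\|f'\|_\infty$ is the supremum of $|f'|$ over the relevant range of values $|s|\le\|u^{\ast}\|_{C^0([0,1]\times[0,T])}$. Neural networks $u_\theta\in C^k([0,T]\times[0,1])$, $\theta\in\Theta\subset\mathbb{R}^M$, are compositions of affine maps and a smooth componentwise scalar activation function (e.g. $\tanh$). Residuals: $\mathcal{R}_{int,\theta}(x,t)=\partial_tu_\theta+\partial_x(f(u_\theta))-\nu\partial_{xx}u_\theta$; $\mathcal{R}_{sb,0,\theta}(t)=u_\theta(0,t)$ and $\mathcal{R}_{sb,1,\theta}(t)=u_\theta(1,t)$; $\mathcal{R}_{tb,\theta}(x)=u_\theta(x,0)-\bar u(x)$. They lie in $C^{k-2}([0,1]\times[0,T])$, $C^k([0,T])$, $C^k([0,1])$, respectively. Training points and positive quadrature weights: $N_{int}$ points $(x_n,t_n)\in(0,1)\times(0,T)$ with weights $w_n^{int}$; spatial boundary points $(0,t_n)$ and $(1,t_n)$, $1\le n\le N_{sb}$, $t_n\in[0,T]$, with weights $w_n^{sb}$; $N_{tb}$ points $x_n\in(0,1)$ with weights $w_n^{tb}$. Assumed quadrature bounds, with $\alpha_{tb},\alpha_{sb},\alpha_{int}>0$: $$\Big|\int_0^1g\,dx-\sum_{n=1}^{N_{tb}}w_n^{tb}g(x_n)\Big|\le C_{quad}^{tb}(\|g\|_{C^k})N_{tb}^{-\alpha_{tb}},\quad g\in C^k([0,1]),$$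 $$\Big|\int_0^Tg\,dt-\sum_{n=1}^{N_{sb}}w_n^{sb}g(t_n)\Big|\le C_{quad}^{sb}(\|g\|_{C^k})N_{sb}^{-\alpha_{sb}},\quad g\in C^k([0,T]),$$ $$\Big|\int_0^T\!\!\int_0^1g\,dx\,dt-\sum_{n=1}^{N_{int}}w_n^{int}g(x_n,t_n)\Big|\le C_{quad}^{int}(\|g\|_{C^{k-2}})N_{int}^{-\alpha_{int}},\quad g\in C^{k-2}([0,1]\times[0,T]).$$ Training errors: $(\mathcal{E}_T^{int})^2=\sum_{n=1}^{N_{int}}w_n^{int}|\mathcal{R}_{int,\theta^{\ast}}(x_n,t_n)|^2$, $(\mathcal{E}_T^{tb})^2=\sum_{n=1}^{N_{tb}}w_n^{tb}|\mathcal{R}_{tb,\theta^{\ast}}(x_n)|^2$, $(\mathcal{E}_T^{sb,i})^2=\sum_{n=1}^{N_{sb}}w_n^{sb}|\mathcal{R}_{sb,i,\theta^{\ast}}(t_n)|^2$ for $i=0,1$. PINN algorithm: return $\theta^{\ast}\in\Theta$, an (approximate, local) minimizer of $J(\theta)+\lambda_{reg}J_{reg}(\theta)$, where $$J(\theta)=\sum_{n=1}^{N_{tb}}w_n^{tb}|\mathcal{R}_{tb,\theta}(x_n)|^2+\sum_{i=0}^1\sum_{n=1}^{N_{sb}}w_n^{sb}|\mathcal{R}_{sb,i,\theta}(t_n)|^2+\lambda\sum_{n=1}^{N_{int}}w_n^{int}|\mathcal{R}_{int,\theta}(x_n,t_n)|^2,$$ $\lambda>0$ is a hyperparameter, $J_{reg}:\Theta\to\mathbb{R}$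 a regularization term, $\lambda_{reg}\ge0$. The PINN is $u^{\ast}=u_{\theta^{\ast}}$. No quantitative property of the minimization is assumed. *)

theory Defs
  imports "HOL-Analysis.Analysis"
begin

section \<open>Spaces \<open>C\<^sup>k\<close> on intervals and on rectangles\<close>

text \<open>
  Derivatives are taken within the domain, hence they are one-sided at boundary points that belong
  to it. On a rectangle \<open>X \<times> I\<close> the first argument of a function is the space variable and the
  second one is the time variable. All intervals are meant to have more than one point.
\<close>

definition der :: "real set \<Rightarrow> (real \<Rightarrow> real) \<Rightarrow> real \<Rightarrow> real" where
  "der X g x = vector_derivative g (at x within X)"

definition pd_x :: "real set \<Rightarrow> (real \<Rightarrow> real \<Rightarrow> real) \<Rightarrow> real \<Rightarrow> real \<Rightarrow> real" where
  "pd_x X g x t = vector_derivative (\<lambda>y. g y t) (at x within X)"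

definition pd_t :: "real set \<Rightarrow> (real \<Rightarrow> real \<Rightarrow> real) \<Rightarrow> real \<Rightarrow> real \<Rightarrow> real" where
  "pd_t I g x t = vector_derivative (\<lambda>s. g x s) (at t within I)"

fun Ck_on :: "nat \<Rightarrow> real set \<Rightarrow> (real \<Rightarrow> real) \<Rightarrow> bool" where
  "Ck_on 0 X g \<longleftrightarrow> continuous_on X g"
| "Ck_on (Suc k) X g \<longleftrightarrow>
     (\<forall>x\<in>X. g differentiable (at x within X)) \<and> Ck_on k X (der X g)"

text \<open>
  All partial derivatives of order at most \<open>k\<close>, taken in every order of \<open>x\<close> and \<open>t\<close>, exist and are
  jointly continuous.
\<close>

fun Ck_on2 :: "nat \<Rightarrow> real set \<Rightarrow> real set \<Rightarrow> (real \<Rightarrow> real \<Rightarrow> real) \<Rightarrow> bool" where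
  "Ck_on2 0 X I g \<longleftrightarrow> continuous_on (X \<times> I) (\<lambda>(x, t). g x t)"
| "Ck_on2 (Suc k) X I g \<longleftrightarrow>
     continuous_on (X \<times> I) (\<lambda>(x, t). g x t) \<and>
     (\<forall>x\<in>X. \<forall>t\<in>I. (\<lambda>y. g y t) differentiable (at x within X) \<and>
                  (\<lambda>s. g x s) differentiable (at t within I)) \<and>
     Ck_on2 k X I (pd_x X g) \<and> Ck_on2 k X I (pd_t I g)"

text \<open>
  The suprema below are meaningful only for bounded functions (automatic for continuous functions
  on compact domains, and assumed explicitly elsewhere). For a continuous function on a rectangle
  \<open>sup_norm2\<close> is also the \<open>L\<^sup>\<infinity>\<close> norm.
\<close>

definition sup_norm :: "real set \<Rightarrow> (real \<Rightarrow> real) \<Rightarrow> real" where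
  "sup_norm X g = (SUP x\<in>X. \<bar>g x\<bar>)"

definition sup_norm2 :: "real set \<Rightarrow> real set \<Rightarrow> (real \<Rightarrow> real \<Rightarrow> real) \<Rightarrow> real" where
  "sup_norm2 X I g = (SUP (x, t)\<in>X \<times> I. \<bar>g x t\<bar>)"

definition bounded_on2 :: "real set \<Rightarrow> real set \<Rightarrow> (real \<Rightarrow> real \<Rightarrow> real) \<Rightarrow> bool" where
  "bounded_on2 X I g \<longleftrightarrow> (\<exists>B. \<forall>x\<in>X. \<forall>t\<in>I. \<bar>g x t\<bar> \<le> B)"

definition Ck_norm :: "nat \<Rightarrow> real set \<Rightarrow> (real \<Rightarrow> real) \<Rightarrow> real" where
  "Ck_norm k X g = (MAX i\<in>{..k}. sup_norm X ((der X ^^ i) g))"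

definition Ck_norm2 :: "nat \<Rightarrow> real set \<Rightarrow> real set \<Rightarrow> (real \<Rightarrow> real \<Rightarrow> real) \<Rightarrow> real" where
  "Ck_norm2 k X I g =
     (MAX (i, j)\<in>{(i, j). i + j \<le> k}. sup_norm2 X I ((pd_x X ^^ i) ((pd_t I ^^ j) g)))"

section \<open>The viscous scalar conservation law\<close>

text \<open>
  A solution of class \<open>C\<^sup>k\<close> is a function on \<open>[0,1] \<times> [0,T)\<close>; nothing is assumed about its values
  at the final time, which do not influence any of the quantities below.
\<close>

definition classical_solution ::
  "real \<Rightarrow> nat \<Rightarrow> (real \<Rightarrow> real) \<Rightarrow> real \<Rightarrow> (real \<Rightarrow> real) \<Rightarrow> (real \<Rightarrow> real \<Rightarrow> real) \<Rightarrow> bool" where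
  "classical_solution \<nu> k f T ubar u \<longleftrightarrow>
     Ck_on2 k {0..1} {0..<T} u \<and>
     (\<forall>x\<in>{0<..<1}. \<forall>t\<in>{0..<T}.
        pd_t {0..<T} u x t + pd_x {0..1} (\<lambda>y s. f (u y s)) x t
          = \<nu> * pd_x {0..1} (pd_x {0..1} u) x t) \<and>
     (\<forall>x\<in>{0<..<1}. u x 0 = ubar x) \<and>
     (\<forall>t\<in>{0..<T}. u 0 t = 0 \<and> u 1 t = 0)"

section \<open>Feed-forward neural networks\<close>

text \<open>
  A parameter vector \<open>p \<in> \<real>\<^sup>M\<close> is a list of length \<open>M\<close>. A layer with \<open>m\<close> inputs and \<open>n\<close> outputs uses
  its first \<open>n * m\<close> entries as the weight matrix (row by row) and the next \<open>n\<close> entries as the bias;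
  the remaining entries are left to the subsequent layers.
\<close>

definition affine_layer :: "nat \<Rightarrow> nat \<Rightarrow> real list \<Rightarrow> real list \<Rightarrow> real list" where
  "affine_layer m n p y = map (\<lambda>i. (\<Sum>j<m. p ! (i * m + j) * y ! j) + p ! (n * m + i)) [0..<n]"

text \<open>The list argument of \<open>num_params\<close> and \<open>network\<close> consists of the widths of all layers.\<close>

fun num_params :: "nat list \<Rightarrow> nat" where
  "num_params (m # n # ds) = n * (m + 1) + num_params (n # ds)"
| "num_params [m] = 0"
| "num_params [] = 0"

fun network :: "(real \<Rightarrow> real) \<Rightarrow> nat list \<Rightarrow> real list \<Rightarrow> real list \<Rightarrow> real list" where
  "network \<sigma> (m # n # l # ds) p y =
     network \<sigma> (n # l # ds) (drop (n * (m + 1)) p) (map \<sigma> (affine_layer m n p y))"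
| "network \<sigma> [m, n] p y = affine_layer m n p y"
| "network \<sigma> [m] p y = y"
| "network \<sigma> [] p y = y"

definition architecture :: "nat list \<Rightarrow> bool" where
  "architecture ds \<longleftrightarrow> length ds \<ge> 2 \<and> hd ds = 2 \<and> last ds = 1 \<and> (\<forall>d\<in>set ds. d > 0)"

definition net_fun :: "(real \<Rightarrow> real) \<Rightarrow> nat list \<Rightarrow> real list \<Rightarrow> real \<Rightarrow> real \<Rightarrow> real" where
  "net_fun \<sigma> ds \<theta> x t = hd (network \<sigma> ds \<theta> [x, t])"

definition smooth_activation :: "(real \<Rightarrow> real) \<Rightarrow> bool" where
  "smooth_activation \<sigma> \<longleftrightarrow> (\<forall>m. Ck_on m UNIV \<sigma>)"

section \<open>Residuals, training set and loss\<close>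

definition R_int ::
  "real \<Rightarrow> (real \<Rightarrow> real) \<Rightarrow> real \<Rightarrow> (real \<Rightarrow> real \<Rightarrow> real) \<Rightarrow> real \<Rightarrow> real \<Rightarrow> real" where
  "R_int \<nu> f T v x t =
     pd_t {0..T} v x t + pd_x {0..1} (\<lambda>y s. f (v y s)) x t
       - \<nu> * pd_x {0..1} (pd_x {0..1} v) x t"

definition R_sb :: "nat \<Rightarrow> (real \<Rightarrow> real \<Rightarrow> real) \<Rightarrow> real \<Rightarrow> real" where
  "R_sb i v t = v (real i) t"

definition R_tb :: "(real \<Rightarrow> real) \<Rightarrow> (real \<Rightarrow> real \<Rightarrow> real) \<Rightarrow> real \<Rightarrow> real" where
  "R_tb ubar v x = v x 0 - ubar x"

text \<open>Points and weights are indexed by \<open>1, \<dots>, N\<close>.\<close>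

record training_set =
  N_int :: nat  x_int :: "nat \<Rightarrow> real"  t_int :: "nat \<Rightarrow> real"  w_int :: "nat \<Rightarrow> real"
  N_sb :: nat   t_sb :: "nat \<Rightarrow> real"   w_sb :: "nat \<Rightarrow> real"
  N_tb :: nat   x_tb :: "nat \<Rightarrow> real"   w_tb :: "nat \<Rightarrow> real"

definition valid_training_set :: "real \<Rightarrow> training_set \<Rightarrow> bool" where
  "valid_training_set T S \<longleftrightarrow>
     N_int S \<ge> 1 \<and> N_sb S \<ge> 1 \<and> N_tb S \<ge> 1 \<and>
     (\<forall>n\<in>{1..N_int S}. x_int S n \<in> {0<..<1} \<and> t_int S n \<in> {0<..<T} \<and> w_int S n > 0) \<and>
     (\<forall>n\<in>{1..N_sb S}. t_sb S n \<in> {0..T} \<and> w_sb S n > 0) \<and>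
     (\<forall>n\<in>{1..N_tb S}. x_tb S n \<in> {0<..<1} \<and> w_tb S n > 0)"

text \<open>The function \<open>C\<close> gives the constant of the error bound in terms of the norm of the integrand.\<close>

definition quad_bound ::
  "nat \<Rightarrow> real \<Rightarrow> real \<Rightarrow> nat \<Rightarrow> (nat \<Rightarrow> real) \<Rightarrow> (nat \<Rightarrow> real) \<Rightarrow> (real \<Rightarrow> real) \<Rightarrow> real \<Rightarrow> bool" where
  "quad_bound k a b N p w C \<alpha> \<longleftrightarrow>
     (\<forall>g. Ck_on k {a..b} g \<longrightarrow>
        \<bar>integral {a..b} g - (\<Sum>n=1..N. w n * g (p n))\<bar>
          \<le> C (Ck_norm k {a..b} g) * real N powr (- \<alpha>))"

definition quad_bound2 ::
  "nat \<Rightarrow> real \<Rightarrow> nat \<Rightarrow> (nat \<Rightarrow> real) \<Rightarrow> (nat \<Rightarrow> real) \<Rightarrow> (nat \<Rightarrow> real) \<Rightarrow> (real \<Rightarrow> real) \<Rightarrow> real \<Rightarrow> bool"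
  where
  "quad_bound2 k T N p q w C \<alpha> \<longleftrightarrow>
     (\<forall>g. Ck_on2 k {0..1} {0..T} g \<longrightarrow>
        \<bar>integral {0..T} (\<lambda>t. integral {0..1} (\<lambda>x. g x t)) - (\<Sum>n=1..N. w n * g (p n) (q n))\<bar>
          \<le> C (Ck_norm2 k {0..1} {0..T} g) * real N powr (- \<alpha>))"

definition E_int ::
  "real \<Rightarrow> (real \<Rightarrow> real) \<Rightarrow> real \<Rightarrow> training_set \<Rightarrow> (real \<Rightarrow> real \<Rightarrow> real) \<Rightarrow> real" where
  "E_int \<nu> f T S v =
     sqrt (\<Sum>n=1..N_int S. w_int S n * \<bar>R_int \<nu> f T v (x_int S n) (t_int S n)\<bar>\<^sup>2)"

definition E_sb :: "nat \<Rightarrow> training_set \<Rightarrow> (real \<Rightarrow> real \<Rightarrow> real) \<Rightarrow> real" where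
  "E_sb i S v = sqrt (\<Sum>n=1..N_sb S. w_sb S n * \<bar>R_sb i v (t_sb S n)\<bar>\<^sup>2)"

definition E_tb :: "(real \<Rightarrow> real) \<Rightarrow> training_set \<Rightarrow> (real \<Rightarrow> real \<Rightarrow> real) \<Rightarrow> real" where
  "E_tb ubar S v = sqrt (\<Sum>n=1..N_tb S. w_tb S n * \<bar>R_tb ubar v (x_tb S n)\<bar>\<^sup>2)"

definition pinn_loss ::
  "real \<Rightarrow> (real \<Rightarrow> real) \<Rightarrow> real \<Rightarrow> (real \<Rightarrow> real) \<Rightarrow> training_set \<Rightarrow> real \<Rightarrow> (real \<Rightarrow> real \<Rightarrow> real) \<Rightarrow> real"
  where
  "pinn_loss \<nu> f T ubar S lam v =
     (\<Sum>n=1..N_tb S. w_tb S n * \<bar>R_tb ubar v (x_tb S n)\<bar>\<^sup>2)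
     + (\<Sum>i=0..1. \<Sum>n=1..N_sb S. w_sb S n * \<bar>R_sb i v (t_sb S n)\<bar>\<^sup>2)
     + lam * (\<Sum>n=1..N_int S. w_int S n * \<bar>R_int \<nu> f T v (x_int S n) (t_int S n)\<bar>\<^sup>2)"

text \<open>
  An approximate local minimizer over \<open>\<Theta>\<close>: optimal up to the tolerance \<open>\<epsilon>\<close> among the parameters at
  Euclidean distance less than \<open>r\<close>.
\<close>

definition approx_local_minimizer ::
  "real \<Rightarrow> real \<Rightarrow> real list set \<Rightarrow> (real list \<Rightarrow> real) \<Rightarrow> real list \<Rightarrow> bool" where
  "approx_local_minimizer \<epsilon> r \<Theta> F p \<longleftrightarrow>
     p \<in> \<Theta> \<and> (\<forall>\<theta>\<in>\<Theta>. L2_set (\<lambda>i. \<theta> ! i - p ! i) {..<length p} < r \<longrightarrow> F p \<le> F \<theta> + \<epsilon>)"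

definition pinn_output ::
  "real \<Rightarrow> (real \<Rightarrow> real) \<Rightarrow> real \<Rightarrow> (real \<Rightarrow> real) \<Rightarrow> training_set \<Rightarrow> (real \<Rightarrow> real) \<Rightarrow> nat list \<Rightarrow>
   real list set \<Rightarrow> real \<Rightarrow> real \<Rightarrow> (real list \<Rightarrow> real) \<Rightarrow> real list \<Rightarrow> bool" where
  "pinn_output \<nu> f T ubar S \<sigma> ds \<Theta> lam lam_reg J_reg p \<longleftrightarrow>
     (\<exists>\<epsilon>\<ge>0. \<exists>r>0. approx_local_minimizer \<epsilon> r \<Theta>
        (\<lambda>\<theta>. pinn_loss \<nu> f T ubar S lam (net_fun \<sigma> ds \<theta>) + lam_reg * J_reg \<theta>) p)"

section \<open>Generalization error and the constants of the estimate\<close>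

definition gen_error :: "real \<Rightarrow> (real \<Rightarrow> real \<Rightarrow> real) \<Rightarrow> (real \<Rightarrow> real \<Rightarrow> real) \<Rightarrow> real" where
  "gen_error T u v = sqrt (integral {0..T} (\<lambda>t. integral {0..1} (\<lambda>x. \<bar>u x t - v x t\<bar>\<^sup>2)))"

text \<open>
  In the following constants \<open>u\<close> is the solution, known on \<open>[0,1] \<times> [0,T)\<close>, and \<open>v\<close> is the network.
\<close>

definition C_fuv ::
  "(real \<Rightarrow> real) \<Rightarrow> real \<Rightarrow> (real \<Rightarrow> real \<Rightarrow> real) \<Rightarrow> (real \<Rightarrow> real \<Rightarrow> real) \<Rightarrow> real" where
  "C_fuv f T u v =
     (let M = max (sup_norm2 {0..1} {0..<T} u) (sup_norm2 {0..1} {0..T} v)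
      in sup_norm {-M..M} (deriv (deriv f)) * sup_norm2 {0..1} {0..<T} (pd_x {0..1} u))"

definition C_main ::
  "(real \<Rightarrow> real) \<Rightarrow> real \<Rightarrow> (real \<Rightarrow> real \<Rightarrow> real) \<Rightarrow> (real \<Rightarrow> real \<Rightarrow> real) \<Rightarrow> real" where
  "C_main f T u v = 1 + 2 * C_fuv f T u v"

definition C_bdry :: "real \<Rightarrow> (real \<Rightarrow> real \<Rightarrow> real) \<Rightarrow> (real \<Rightarrow> real \<Rightarrow> real) \<Rightarrow> real" where
  "C_bdry T u v =
     sup_norm2 {0..1} {0..<T} (pd_x {0..1} u) + sup_norm2 {0..1} {0..T} (pd_x {0..1} v)"

definition f'_norm :: "(real \<Rightarrow> real) \<Rightarrow> real \<Rightarrow> (real \<Rightarrow> real \<Rightarrow> real) \<Rightarrow> real" where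
  "f'_norm f T v =
     (let M = sup_norm2 {0..1} {0..T} v in sup_norm {-M..M} (deriv f))"

end

theory Submission
  imports Defs
begin

text \<open>
  Let \<open>w = v - u\<close> be the difference of the network and the solution. Testing the equation for \<open>w\<close> with
  \<open>w\<close> bounds the derivative of \<open>\<integral> w\<^sup>2 dx\<close> by \<open>C \<integral> w\<^sup>2 dx + r(t)\<close>, where \<open>r\<close> collects the squared interior
  residual and the boundary terms: the viscous boundary flux is at most \<open>\<nu> C\<^sub>b\<close> times the boundary values of
  \<open>v\<close>, and the relative entropy flux is quadratic in them with the factor \<open>\<parallel>f'\<parallel>\<close>, so that \<open>\<parallel>f'\<parallel>\<close> serves as
  the constant \<open>Cbar_b\<close>. Gronwall's inequality, \<open>e\<^sup>y \<le> 1 + y e\<^sup>y\<close>, a second integration in time, and the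
  quadrature bounds for the squared residuals give the estimate.
\<close>

section \<open>Energy estimates for scalar functions\<close>

text \<open>The mean value bound is applied twice on the segment: to \<open>f'\<close>, then to
  \<open>f s - f' u * s\<close>, whose derivative is \<open>f' s - f' u\<close>. The constant
  \<open>L\<close> instead of \<open>L / 2\<close> matches the factor 2 in
  \<open>C_main\<close>.\<close>

lemma taylor_first_order_bound:
  fixes f :: "real \<Rightarrow> real"
  assumes f: "\<And>s. (f has_real_derivative f' s) (at s)"
    and f': "\<And>s. (f' has_real_derivative f'' s) (at s)"
    and L: "\<And>s. s \<in> closed_segment u v \<Longrightarrow> \<bar>f'' s\<bar> \<le> L"
  shows "\<bar>f v - f u - f' u * (v - u)\<bar> \<le> L * (v - u)\<^sup>2"
proof -
  let ?S = "closed_segment u v"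
  have L0: "L \<ge> 0" using L[of u] by simp
  have "norm (f' s - f' u) \<le> L * \<bar>v - u\<bar>" if "s \<in> ?S" for s
  proof -
    have "norm (f' s - f' u) \<le> L * norm (s - u)"
      using f' L that by (intro field_differentiable_bound[where S = ?S and f' = f''])
        (auto intro: has_field_derivative_at_within)
    also have "\<dots> \<le> L * \<bar>v - u\<bar>"
      using L0 segment_bound[OF that] by (intro mult_left_mono) simp_all
    finally show ?thesis .
  qed
  then have "norm ((f v - f' u * v) - (f u - f' u * u)) \<le> L * \<bar>v - u\<bar> * norm (v - u)"
    by (intro field_differentiable_bound[where S = ?S and f' = "\<lambda>s. f' s - f' u"])
      (auto intro!: derivative_eq_intros has_field_derivative_at_within[OF f])
  then show ?thesis by (simp add: algebra_simps power2_eq_square)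
qed

text \<open>Cauchy-Schwarz against the constant 1: the square of \<open>\<bar>g t\<bar> - m\<close>,
  with \<open>m\<close> the mean of \<open>\<bar>g\<bar>\<close>, has a nonnegative
  integral.\<close>

lemma integral_abs_le_sqrt_integral_square:
  fixes g :: "real \<Rightarrow> real"
  assumes "a \<le> b" "continuous_on {a..b} g"
  shows "integral {a..b} (\<lambda>t. \<bar>g t\<bar>) \<le> sqrt (b - a) * sqrt (integral {a..b} (\<lambda>t. (g t)\<^sup>2))"
proof (cases "a = b")
  case False
  define J I where "J = integral {a..b} (\<lambda>t. \<bar>g t\<bar>)" and "I = integral {a..b} (\<lambda>t. (g t)\<^sup>2)"
  define m where "m = J / (b - a)"
  have ab: "b - a > 0" using assms False by simp
  have int: "(\<lambda>t. \<bar>g t\<bar>) integrable_on {a..b}" "(\<lambda>t. (g t)\<^sup>2) integrable_on {a..b}"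
    using assms by (auto intro!: integrable_continuous_interval continuous_intros)
  have "((\<lambda>t. m\<^sup>2) has_integral (b - a) * m\<^sup>2) {a..b}"
    using has_integral_const_real[of "m\<^sup>2" a b] ab by simp
  then have "((\<lambda>t. (g t)\<^sup>2 - 2 * m * \<bar>g t\<bar> + m\<^sup>2) has_integral I - 2 * m * J + (b - a) * m\<^sup>2) {a..b}"
    unfolding I_def J_def
    by (intro has_integral_add has_integral_diff has_integral_mult_right integrable_integral int)
  moreover have "(g t)\<^sup>2 - 2 * m * \<bar>g t\<bar> + m\<^sup>2 \<ge> 0" for t
    using zero_le_power2[of "\<bar>g t\<bar> - m"] by (simp add: power2_diff algebra_simps)
  ultimately have "0 \<le> I - 2 * m * J + (b - a) * m\<^sup>2"
    by (rule has_integral_nonneg)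
  moreover have J: "(b - a) * m = J"
    using ab by (simp add: m_def)
  then have "(b - a) * m\<^sup>2 = J * m"
    by (simp add: power2_eq_square flip: mult.assoc)
  ultimately have "J * m \<le> I"
    by (simp add: mult.assoc mult.commute[of m])
  then have "J\<^sup>2 \<le> (b - a) * I"
    using ab mult_left_mono[of "J * m" I "b - a"] J
    by (simp add: power2_eq_square mult.left_commute[of "b - a" J m])
  then show ?thesis
    unfolding I_def[symmetric] J_def[symmetric] real_sqrt_mult[symmetric]
    by (rule real_le_rsqrt)
qed simp

lemma has_integral_sqrt:
  assumes "T \<ge> 0"
  shows "(sqrt has_integral 2 / 3 * T * sqrt T) {0..T}"
proof -
  have *: "2 / 3 * T * sqrt T - 2 / 3 * 0 * sqrt 0 = 2 / 3 * T * sqrt T" by simp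
  \<comment> \<open>The interior form of the fundamental theorem avoids differentiating
    \<open>sqrt\<close> at 0.\<close>
  have "(sqrt has_integral (2 / 3 * T * sqrt T - 2 / 3 * 0 * sqrt 0)) {0..T}"
  proof (rule fundamental_theorem_of_calculus_interior[OF assms])
    show "continuous_on {0..T} (\<lambda>t. 2 / 3 * t * sqrt t)" by (intro continuous_intros)
    fix t assume t: "t \<in> {0<..<T}"
    have "((\<lambda>t. 2 / 3 * t * sqrt t) has_real_derivative 2 / 3 * sqrt t + 2 / 3 * t * (inverse (sqrt t) / 2)) (at t)"
      using t by (auto intro!: derivative_eq_intros)
    also have "2 / 3 * sqrt t + 2 / 3 * t * (inverse (sqrt t) / 2) = sqrt t"
      using t real_sqrt_mult_self[of t] by (simp add: field_simps)
    finally show "((\<lambda>t. 2 / 3 * t * sqrt t) has_vector_derivative sqrt t) (at t)"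
      by (simp add: has_real_derivative_iff_has_vector_derivative)
  qed
  then show ?thesis unfolding * .
qed

lemma gronwall_differential:
  fixes W :: "real \<Rightarrow> real"
  assumes "\<tau> \<ge> 0" "C \<ge> 0"
    and W: "\<And>t. t \<in> {0..\<tau>} \<Longrightarrow> (W has_real_derivative W' t) (at t within {0..\<tau>})"
    and le: "\<And>t. t \<in> {0..\<tau>} \<Longrightarrow> W' t \<le> C * W t + r t"
    and r: "r integrable_on {0..\<tau>}" "\<And>t. t \<in> {0..\<tau>} \<Longrightarrow> r t \<ge> 0"
  shows "W \<tau> \<le> exp (C * \<tau>) * (W 0 + integral {0..\<tau>} r)"
proof -
  have "((\<lambda>t. exp (- C * t) * (W' t - C * W t)) has_integral
      exp (- C * \<tau>) * W \<tau> - exp (- C * 0) * W 0) {0..\<tau>}"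
    using assms(1)
  proof (rule fundamental_theorem_of_calculus)
    fix t assume "t \<in> {0..\<tau>}"
    then show "((\<lambda>t. exp (- C * t) * W t) has_vector_derivative exp (- C * t) * (W' t - C * W t)) (at t within {0..\<tau>})"
      unfolding has_real_derivative_iff_has_vector_derivative[symmetric]
      by (auto intro!: derivative_eq_intros W simp: algebra_simps)
  qed
  moreover have "exp (- C * t) * (W' t - C * W t) \<le> r t" if t: "t \<in> {0..\<tau>}" for t
  proof -
    have "exp (- C * t) * (W' t - C * W t) \<le> exp (- C * t) * r t"
      using le[OF t] by (intro mult_left_mono) auto
    also have "\<dots> \<le> 1 * r t"
      using r(2)[OF t] t assms(2) by (intro mult_right_mono) auto
    finally show ?thesis by simp
  qed
  ultimately have "exp (- C * \<tau>) * W \<tau> - W 0 \<le> integral {0..\<tau>} r"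
    using has_integral_le[OF _ integrable_integral[OF r(1)]] by fastforce
  then have "exp (C * \<tau>) * (exp (- C * \<tau>) * W \<tau>) \<le> exp (C * \<tau>) * (W 0 + integral {0..\<tau>} r)"
    by (intro mult_left_mono) auto
  then show ?thesis by (simp add: mult.assoc[symmetric] exp_add[symmetric])
qed

text \<open>
  The nonlinear term is treated with the relative entropy flux
  \<open>H = Q(v) - Q(u) - u (f(v) - f(u))\<close>, where \<open>Q'(s) = s f'(s)\<close>. It satisfies
  \<open>(v - u) (f(v) - f(u))\<^sub>x = H\<^sub>x + u\<^sub>x (f(v) - f(u) - f'(u) (v - u))\<close>.
\<close>

lemma conservation_law_energy_estimate:
  fixes f f' f'' u v ux vx uxx vxx wt R :: "real \<Rightarrow> real"
  assumes f: "\<And>s. (f has_real_derivative f' s) (at s)"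
    and f': "\<And>s. (f' has_real_derivative f'' s) (at s)"
    and u: "\<And>x. x \<in> {0..1} \<Longrightarrow> (u has_real_derivative ux x) (at x within {0..1})"
    and ux: "\<And>x. x \<in> {0..1} \<Longrightarrow> (ux has_real_derivative uxx x) (at x within {0..1})"
    and v: "\<And>x. x \<in> {0..1} \<Longrightarrow> (v has_real_derivative vx x) (at x within {0..1})"
    and vx: "\<And>x. x \<in> {0..1} \<Longrightarrow> (vx has_real_derivative vxx x) (at x within {0..1})"
    and cont: "continuous_on {0..1} wt" "continuous_on {0..1} R"
    and eq: "\<And>x. x \<in> {0<..<1} \<Longrightarrow>
      wt x + f' (v x) * vx x - f' (u x) * ux x = \<nu> * (vxx x - uxx x) + R x"
    and bdry: "u 0 = 0" "u 1 = 0"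
    and M: "\<And>x. x \<in> {0..1} \<Longrightarrow> \<bar>u x\<bar> \<le> M" "\<And>x. x \<in> {0..1} \<Longrightarrow> \<bar>v x\<bar> \<le> M"
    and m: "\<And>x. x \<in> {0..1} \<Longrightarrow> \<bar>v x\<bar> \<le> m"
    and L: "\<And>s. \<bar>s\<bar> \<le> M \<Longrightarrow> \<bar>f'' s\<bar> \<le> L"
    and a: "\<And>s. \<bar>s\<bar> \<le> m \<Longrightarrow> \<bar>f' s\<bar> \<le> a"
    and P: "\<And>x. x \<in> {0..1} \<Longrightarrow> \<bar>ux x\<bar> \<le> P" "\<And>x. x \<in> {0..1} \<Longrightarrow> \<bar>vx x\<bar> \<le> V"
    and \<nu>: "\<nu> \<ge> 0"
  shows "integral {0..1} (\<lambda>x. 2 * (v x - u x) * wt x)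
    \<le> integral {0..1} (\<lambda>x. (R x)\<^sup>2) + (1 + 2 * (L * P)) * integral {0..1} (\<lambda>x. (v x - u x)\<^sup>2)
      + 2 * a * ((v 0)\<^sup>2 + (v 1)\<^sup>2) + 2 * \<nu> * (P + V) * (\<bar>v 0\<bar> + \<bar>v 1\<bar>)"
proof -
  have c: "continuous_on {0..1} u" "continuous_on {0..1} v" "continuous_on {0..1} ux" "continuous_on {0..1} vx"
    using u v ux vx by (blast intro: DERIV_continuous_on)+
  have cf: "continuous_on S f" "continuous_on S f'" for S
    using f f' by (meson DERIV_continuous_on has_field_derivative_at_within)+
  \<comment> \<open>The margin 1 puts every \<open>s\<close> with
    \<open>\<bar>s\<bar> \<le> M\<close> in the interior, so that the antiderivative
    \<open>Q\<close> has a two-sided derivative there.\<close>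
  have "continuous_on {- M - 1..M + 1} (\<lambda>s. s * f' s)"
    by (intro continuous_intros cf)
  then obtain Q where Q0: "\<And>s. s \<in> {- M - 1..M + 1} \<Longrightarrow>
      (Q has_vector_derivative (s * f' s)) (at s within {- M - 1..M + 1})"
    using antiderivative_continuous by blast
  have Q: "(Q has_real_derivative s * f' s) (at s)" if "\<bar>s\<bar> \<le> M" for s
  proof -
    have "at s within {- M - 1..M + 1} = at s"
      using that by (intro at_within_interior) (simp add: abs_le_iff)
    then show ?thesis
      using Q0[of s] that by (simp add: has_real_derivative_iff_has_vector_derivative abs_le_iff)
  qed
  \<comment> \<open>On the segment from 0 to \<open>v x\<close> the derivative
    \<open>s * f' s\<close> is at most \<open>\<bar>v x\<bar> * a\<close>, and the segment has
    length \<open>\<bar>v x\<bar>\<close>. Only values of \<open>f'\<close> on the range of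
    \<open>v\<close> enter, which is why \<open>a\<close> refers to \<open>m\<close> and not to
    \<open>M\<close>.\<close>
  have Qbound: "\<bar>Q (v x) - Q 0\<bar> \<le> a * (v x)\<^sup>2" if x: "x \<in> {0..1}" for x
  proof -
    let ?S = "closed_segment 0 (v x)"
    have S: "\<bar>s\<bar> \<le> \<bar>v x\<bar>" if "s \<in> ?S" for s
      using segment_bound[OF that] by simp
    have "norm (Q (v x) - Q 0) \<le> \<bar>v x\<bar> * a * norm (v x - 0)"
    proof (rule field_differentiable_bound[where S = ?S and f' = "\<lambda>s. s * f' s"])
      fix s assume s: "s \<in> ?S"
      then show "(Q has_field_derivative s * f' s) (at s within ?S)"
        using S[OF s] M(2)[OF x] by (intro has_field_derivative_at_within[OF Q]) auto
      show "norm (s * f' s) \<le> \<bar>v x\<bar> * a"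
        unfolding real_norm_def abs_mult
        using S[OF s] m[OF x] by (intro mult_mono a) auto
    qed auto
    then show ?thesis by (simp add: power2_eq_square ac_simps flip: abs_mult)
  qed
  define H where "H x = Q (v x) - Q (u x) - u x * (f (v x) - f (u x))" for x
  \<comment> \<open>\<open>G\<close> is the total flux, viscous minus entropy part. Its derivative
    \<open>G'\<close> dominates \<open>h\<close>, the energy production with the residual and
    zeroth-order terms subtracted, so that only the values of \<open>G\<close> at 0 and 1 remain
    after integration.\<close>
  define G where "G x = 2 * \<nu> * ((v x - u x) * (vx x - ux x)) - 2 * H x" for x
  define G' where "G' x = 2 * \<nu> * ((vx x - ux x)\<^sup>2 + (v x - u x) * (vxx x - uxx x))
    - 2 * ((v x - u x) * f' (v x) * vx x - ux x * (f (v x) - f (u x)))" for x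
  define h where "h x = 2 * (v x - u x) * wt x - (R x)\<^sup>2 - (1 + 2 * (L * P)) * (v x - u x)\<^sup>2" for x
  have L0: "L \<ge> 0" using L[of "u 0"] M(1)[of 0] by simp
  have contG: "continuous_on {0..1} G"
  proof -
    have QM: "continuous_on {- M..M} Q"
      by (intro DERIV_continuous_on[where D = "\<lambda>s. s * f' s"] has_field_derivative_at_within[OF Q]) auto
    have "continuous_on {0..1} (\<lambda>x. Q (v x))" "continuous_on {0..1} (\<lambda>x. Q (u x))"
      using M by (auto intro!: continuous_on_compose2[OF QM] c simp: abs_le_iff) force+
    moreover have "continuous_on {0..1} (\<lambda>x. f (v x))" "continuous_on {0..1} (\<lambda>x. f (u x))"
      using c by (auto intro!: continuous_on_compose2[OF cf(1)[of UNIV]])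
    ultimately show ?thesis
      unfolding G_def H_def by (intro continuous_intros c)
  qed
  have derG: "(G has_real_derivative G' x) (at x)" if x: "x \<in> {0<..<1}" for x
  proof -
    have x': "x \<in> {0..1}" using x by auto
    have at: "at x within {0..1} = at x"
      using x by (intro at_within_interior) auto
    note d = u[OF x', unfolded at] v[OF x', unfolded at] ux[OF x', unfolded at] vx[OF x', unfolded at]
    show ?thesis
      unfolding G_def H_def G'_def
      by (rule derivative_eq_intros refl d
          DERIV_chain2[where f = Q and g = u, OF Q[OF M(1)[OF x']]]
          DERIV_chain2[where f = Q and g = v, OF Q[OF M(2)[OF x']]]
          DERIV_chain2[where f = f and g = u, OF f]
          DERIV_chain2[where f = f and g = v, OF f])+
        (simp add: algebra_simps power2_eq_square)
  qed
  have le: "h x \<le> G' x" if x: "x \<in> {0<..<1}" for x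
  proof -
    have x': "x \<in> {0..1}" using x by auto
    define e where "e = f (v x) - f (u x) - f' (u x) * (v x - u x)"
    have "\<bar>e\<bar> \<le> L * (v x - u x)\<^sup>2"
      unfolding e_def
    proof (rule taylor_first_order_bound[OF f f' L])
      fix s assume "s \<in> closed_segment (u x) (v x)"
      then show "\<bar>s\<bar> \<le> M"
        using M[OF x'] by (auto simp: closed_segment_eq_real_ivl abs_le_iff split: if_splits)
    qed
    then have "\<bar>ux x * e\<bar> \<le> P * (L * (v x - u x)\<^sup>2)"
      unfolding abs_mult using P(1)[OF x'] by (intro mult_mono) auto
    then have 1: "- (2 * (ux x * e)) \<le> 2 * (L * P) * (v x - u x)\<^sup>2"
      by (simp add: algebra_simps abs_le_iff)
    have 2: "2 * (v x - u x) * R x \<le> (R x)\<^sup>2 + (v x - u x)\<^sup>2"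
      using zero_le_power2[of "R x - (v x - u x)"] by (simp add: power2_eq_square algebra_simps)
    \<comment> \<open>This is the viscous dissipation; it has a favourable sign and is
      discarded.\<close>
    have 3: "0 \<le> 2 * \<nu> * (vx x - ux x)\<^sup>2" using \<nu> by simp
    have wt: "wt x = \<nu> * (vxx x - uxx x) + R x - f' (v x) * vx x + f' (u x) * ux x"
      using eq[OF x] by simp
    \<comment> \<open>All second derivatives and flux derivatives cancel; what is left is the
      residual, the dissipation and the Taylor remainder \<open>e\<close> multiplied by
      \<open>ux x\<close>.\<close>
    have "2 * (v x - u x) * wt x - G' x
      = 2 * (v x - u x) * R x - 2 * \<nu> * (vx x - ux x)\<^sup>2 - 2 * (ux x * e)"
      unfolding wt G'_def e_def by algebra
    then show ?thesis
      using 1 2 3 unfolding h_def by (simp add: algebra_simps)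
  qed
  have int: "(\<lambda>x. 2 * (v x - u x) * wt x) integrable_on {0..1}" "(\<lambda>x. (R x)\<^sup>2) integrable_on {0..1}"
    "(\<lambda>x. (v x - u x)\<^sup>2) integrable_on {0..1}"
    by (intro integrable_continuous_interval continuous_intros c cont)+
  have "(h has_integral integral {0..1} (\<lambda>x. 2 * (v x - u x) * wt x) - integral {0..1} (\<lambda>x. (R x)\<^sup>2)
      - (1 + 2 * (L * P)) * integral {0..1} (\<lambda>x. (v x - u x)\<^sup>2)) {0..1}"
    unfolding h_def by (intro has_integral_diff has_integral_mult_right integrable_integral int)
  \<comment> \<open>The bound \<open>h x \<le> G' x\<close> is known only in the interior. Setting
    the integrand to \<open>h\<close> at the two endpoints leaves the integral unchanged and makes
    the comparison hold on the whole interval.\<close>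
  moreover have "((\<lambda>x. if x \<in> {0<..<1} then G' x else h x) has_integral G 1 - G 0) {0..1}"
    using derG contG by (intro fundamental_theorem_of_calculus_interior)
      (auto simp flip: has_real_derivative_iff_has_vector_derivative)
  ultimately have "integral {0..1} (\<lambda>x. 2 * (v x - u x) * wt x) - integral {0..1} (\<lambda>x. (R x)\<^sup>2)
      - (1 + 2 * (L * P)) * integral {0..1} (\<lambda>x. (v x - u x)\<^sup>2) \<le> G 1 - G 0"
    using le by (rule_tac has_integral_le) auto
  \<comment> \<open>Where \<open>u\<close> vanishes, \<open>H x\<close> reduces to
    \<open>Q (v x) - Q 0\<close>, hence to a term quadratic in the boundary value of
    \<open>v\<close>, while the viscous flux is linear in it.\<close>
  moreover have "\<bar>G x\<bar> \<le> 2 * \<nu> * (P + V) * \<bar>v x\<bar> + 2 * a * (v x)\<^sup>2" if x: "x \<in> {0..1}" "u x = 0" for x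
  proof -
    have "G x = 2 * \<nu> * (v x * (vx x - ux x)) - 2 * (Q (v x) - Q 0)"
      by (simp add: G_def H_def x(2))
    then have "\<bar>G x\<bar> \<le> \<bar>2 * \<nu> * (v x * (vx x - ux x))\<bar> + \<bar>2 * (Q (v x) - Q 0)\<bar>"
      using abs_triangle_ineq4 by metis
    also have "\<dots> = 2 * \<nu> * (\<bar>v x\<bar> * \<bar>vx x - ux x\<bar>) + 2 * \<bar>Q (v x) - Q 0\<bar>"
      using \<nu> unfolding abs_mult by simp
    also have "\<dots> \<le> 2 * \<nu> * (\<bar>v x\<bar> * (P + V)) + 2 * (a * (v x)\<^sup>2)"
      using \<nu> Qbound[OF x(1)] P[OF x(1)] by (intro add_mono mult_left_mono) auto
    finally show ?thesis by (simp add: algebra_simps)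
  qed
  from this[of 0] this[of 1] bdry
  have "\<bar>G 0\<bar> \<le> 2 * \<nu> * (P + V) * \<bar>v 0\<bar> + 2 * a * (v 0)\<^sup>2" "\<bar>G 1\<bar> \<le> 2 * \<nu> * (P + V) * \<bar>v 1\<bar> + 2 * a * (v 1)\<^sup>2"
    by simp_all
  ultimately show ?thesis by (simp add: algebra_simps abs_le_iff)
qed

section \<open>Closure properties of \<open>C\<^sup>k\<close> functions\<close>

lemma at_within_Icc_neq_bot:
  fixes a b :: real
  assumes "a < b" "x \<in> {a..b}"
  shows "at x within {a..b} \<noteq> bot"
  using assms by (simp add: trivial_limit_within islimpt_Icc)

lemma at_within_Ico_neq_bot:
  fixes a b :: real
  assumes "a < b" "x \<in> {a..<b}"
  shows "at x within {a..<b} \<noteq> bot"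
  using assms by (simp add: trivial_limit_within islimpt_Ico)

lemma Ck_on2_imp_continuous: "Ck_on2 k X I g \<Longrightarrow> continuous_on (X \<times> I) (\<lambda>(x, t). g x t)"
  by (cases k) auto

lemma Ck_on2_Suc_imp: "Ck_on2 (Suc k) X I g \<Longrightarrow> Ck_on2 k X I g"
proof (induction k arbitrary: g)
  case (Suc k)
  then show ?case
    unfolding Ck_on2.simps(2)[of "Suc k"] Ck_on2.simps(2)[of k X I g] by blast
qed simp

lemma Ck_on_slice_x: "Ck_on2 k X I g \<Longrightarrow> t \<in> I \<Longrightarrow> Ck_on k X (\<lambda>x. g x t)"
proof (induction k arbitrary: g)
  case 0
  have "continuous_on X ((\<lambda>(x, t). g x t) \<circ> (\<lambda>x. (x, t)))"
    using 0 by (intro continuous_on_compose continuous_intros) (auto elim: continuous_on_subset)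
  then show ?case by (simp add: o_def)
next
  case (Suc k)
  then have "Ck_on k X (\<lambda>x. pd_x X g x t)" by simp
  moreover have "der X (\<lambda>x. g x t) = (\<lambda>x. pd_x X g x t)" by (simp add: fun_eq_iff der_def pd_x_def)
  ultimately show ?case using Suc by simp
qed

lemma Ck_on_slice_t: "Ck_on2 k X I g \<Longrightarrow> x \<in> X \<Longrightarrow> Ck_on k I (g x)"
proof (induction k arbitrary: g)
  case 0
  have "continuous_on I ((\<lambda>(x, t). g x t) \<circ> Pair x)"
    using 0 by (intro continuous_on_compose continuous_intros) (auto elim: continuous_on_subset)
  then show ?case by (simp add: o_def)
next
  case (Suc k)
  then have "Ck_on k I (pd_t I g x)" by simp
  moreover have "der I (g x) = pd_t I g x" by (simp add: fun_eq_iff der_def pd_t_def)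
  ultimately show ?case using Suc by simp
qed

lemma pd_x_has_vector_derivative:
  assumes "Ck_on2 (Suc k) X I g" "x \<in> X" "t \<in> I"
  shows "((\<lambda>y. g y t) has_vector_derivative pd_x X g x t) (at x within X)"
  using assms by (auto simp: pd_x_def vector_derivative_works)

lemma pd_t_has_vector_derivative:
  assumes "Ck_on2 (Suc k) X I g" "x \<in> X" "t \<in> I"
  shows "(g x has_vector_derivative pd_t I g x t) (at t within I)"
  using assms by (auto simp: pd_t_def vector_derivative_works)

section \<open>Calculus of \<open>Ck_on2\<close>\<close>

text \<open>Nontrivial filters make derivatives within the domain unique, so \<open>pd_x\<close> and
  \<open>pd_t\<close> can be read off from any derivative that has been exhibited. The assumptions
  cover both the closed and the half-open time interval.\<close>

locale Ck_domain =
  fixes X I :: "real set"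
  assumes X_nontrivial: "x \<in> X \<Longrightarrow> at x within X \<noteq> bot"
    and I_nontrivial: "t \<in> I \<Longrightarrow> at t within I \<noteq> bot"
begin

lemma pd_x_eq:
  assumes "((\<lambda>y. g y t) has_vector_derivative d) (at x within X)" "x \<in> X"
  shows "pd_x X g x t = d"
  unfolding pd_x_def using assms X_nontrivial by (intro vector_derivative_within)

lemma pd_t_eq:
  assumes "(g x has_vector_derivative d) (at t within I)" "t \<in> I"
  shows "pd_t I g x t = d"
  unfolding pd_t_def using assms I_nontrivial by (intro vector_derivative_within)

text \<open>Derivatives within the domain see only values on the domain, so agreement on the
  rectangle passes to \<open>pd_x\<close> and \<open>pd_t\<close> and the induction goes
  through.\<close>

lemma Ck_on2_cong:
  assumes "Ck_on2 k X I g" "\<And>x t. x \<in> X \<Longrightarrow> t \<in> I \<Longrightarrow> h x t = g x t"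
  shows "Ck_on2 k X I h"
  using assms
proof (induction k arbitrary: g h)
  case 0
  have "continuous_on (X \<times> I) (\<lambda>(x, t). h x t) = continuous_on (X \<times> I) (\<lambda>(x, t). g x t)"
    using "0.prems"(2) by (intro continuous_on_cong) auto
  then show ?case using 0 by simp
next
  case (Suc k)
  have x: "((\<lambda>y. h y t) has_vector_derivative pd_x X g x t) (at x within X)" if "x \<in> X" "t \<in> I" for x t
    using pd_x_has_vector_derivative[OF Suc.prems(1)] that Suc.prems(2)
    by (intro has_vector_derivative_transform[of x X "\<lambda>y. h y t" "\<lambda>y. g y t"]) auto
  have t: "(h x has_vector_derivative pd_t I g x t) (at t within I)" if "x \<in> X" "t \<in> I" for x t
    using pd_t_has_vector_derivative[OF Suc.prems(1)] that Suc.prems(2)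
    by (intro has_vector_derivative_transform[of t I "h x" "g x"]) auto
  have "continuous_on (X \<times> I) (\<lambda>(x, t). h x t) = continuous_on (X \<times> I) (\<lambda>(x, t). g x t)"
    using Suc.prems(2) by (intro continuous_on_cong) auto
  moreover have "Ck_on2 k X I (pd_x X h)"
    by (rule Suc.IH[of "pd_x X g"]) (use Suc.prems(1) in \<open>simp_all add: pd_x_eq[OF x]\<close>)
  moreover have "Ck_on2 k X I (pd_t I h)"
    by (rule Suc.IH[of "pd_t I g"]) (use Suc.prems(1) in \<open>simp_all add: pd_t_eq[OF t]\<close>)
  ultimately show ?case
    using Suc.prems(1) x[THEN differentiableI_vector] t[THEN differentiableI_vector] by simp
qed

text \<open>Introduction rule for the closure proofs: candidates \<open>gx\<close> and
  \<open>gt\<close> given by formulas replace the choice-defined \<open>pd_x\<close> and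
  \<open>pd_t\<close>.\<close>

lemma Ck_on2_SucI:
  assumes "continuous_on (X \<times> I) (\<lambda>(x, t). g x t)"
    and x: "\<And>x t. x \<in> X \<Longrightarrow> t \<in> I \<Longrightarrow> ((\<lambda>y. g y t) has_vector_derivative gx x t) (at x within X)"
    and t: "\<And>x t. x \<in> X \<Longrightarrow> t \<in> I \<Longrightarrow> (g x has_vector_derivative gt x t) (at t within I)"
    and "Ck_on2 k X I gx" "Ck_on2 k X I gt"
  shows "Ck_on2 (Suc k) X I g"
proof -
  have "Ck_on2 k X I (pd_x X g)"
    using assms(4) by (rule Ck_on2_cong) (simp add: pd_x_eq[OF x])
  moreover have "Ck_on2 k X I (pd_t I g)"
    using assms(5) by (rule Ck_on2_cong) (simp add: pd_t_eq[OF t])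
  ultimately show ?thesis
    using assms(1) x[THEN differentiableI_vector] t[THEN differentiableI_vector] by simp
qed

lemma Ck_on2_const: "Ck_on2 k X I (\<lambda>x t. c)"
proof (induction k arbitrary: c)
  case (Suc k)
  show ?case
    by (rule Ck_on2_SucI[where gx = "\<lambda>x t. 0" and gt = "\<lambda>x t. 0"])
      (simp_all add: Suc split_def)
qed (simp add: split_def)

lemma Ck_on2_add:
  "Ck_on2 k X I g \<Longrightarrow> Ck_on2 k X I h \<Longrightarrow> Ck_on2 k X I (\<lambda>x t. g x t + h x t)"
proof (induction k arbitrary: g h)
  case 0
  then show ?case by (auto intro: continuous_intros simp: split_def)
next
  case (Suc k)
  note c = Suc.prems[THEN Ck_on2_imp_continuous]
  show ?case
  proof (rule Ck_on2_SucI)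
    show "continuous_on (X \<times> I) (\<lambda>(x, t). g x t + h x t)"
      using c by (auto intro: continuous_intros simp: split_def)
  next
    fix x t assume "x \<in> X" "t \<in> I"
    then show "((\<lambda>y. g y t + h y t) has_vector_derivative pd_x X g x t + pd_x X h x t) (at x within X)"
      "((\<lambda>s. g x s + h x s) has_vector_derivative pd_t I g x t + pd_t I h x t) (at t within I)"
      using has_vector_derivative_add[OF Suc.prems[THEN pd_x_has_vector_derivative]]
        has_vector_derivative_add[OF Suc.prems[THEN pd_t_has_vector_derivative]] by simp_all
  qed (use Suc.prems in \<open>simp_all add: Suc.IH\<close>)
qed

lemma Ck_on2_mult:
  "Ck_on2 k X I g \<Longrightarrow> Ck_on2 k X I h \<Longrightarrow> Ck_on2 k X I (\<lambda>x t. g x t * h x t)"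
proof (induction k arbitrary: g h)
  case 0
  then show ?case by (auto intro: continuous_intros simp: split_def)
next
  case (Suc k)
  note c = Suc.prems[THEN Ck_on2_imp_continuous]
  note d = Suc.prems[THEN Ck_on2_Suc_imp]
  show ?case
  proof (rule Ck_on2_SucI)
    show "continuous_on (X \<times> I) (\<lambda>(x, t). g x t * h x t)"
      using c by (auto intro: continuous_intros simp: split_def)
  next
    fix x t assume "x \<in> X" "t \<in> I"
    then show "((\<lambda>y. g y t * h y t) has_vector_derivative g x t * pd_x X h x t + pd_x X g x t * h x t) (at x within X)"
      "((\<lambda>s. g x s * h x s) has_vector_derivative g x t * pd_t I h x t + pd_t I g x t * h x t) (at t within I)"
      using has_vector_derivative_mult[OF Suc.prems[THEN pd_x_has_vector_derivative]]
        has_vector_derivative_mult[OF Suc.prems[THEN pd_t_has_vector_derivative]] by simp_all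
  next
    show "Ck_on2 k X I (\<lambda>x t. g x t * pd_x X h x t + pd_x X g x t * h x t)"
      "Ck_on2 k X I (\<lambda>x t. g x t * pd_t I h x t + pd_t I g x t * h x t)"
      using Suc.prems d by (auto intro!: Ck_on2_add Suc.IH)
  qed
qed

lemma Ck_on2_diff:
  "Ck_on2 k X I g \<Longrightarrow> Ck_on2 k X I h \<Longrightarrow> Ck_on2 k X I (\<lambda>x t. g x t - h x t)"
  using Ck_on2_add[of k g "\<lambda>x t. -1 * h x t"] Ck_on2_mult[OF Ck_on2_const[of k "-1"], of h] by simp

lemma Ck_on2_sum:
  "(\<And>i. i \<in> A \<Longrightarrow> Ck_on2 k X I (g i)) \<Longrightarrow> Ck_on2 k X I (\<lambda>x t. \<Sum>i\<in>A. g i x t)"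
  by (induction A rule: infinite_finite_induct) (auto intro: Ck_on2_add Ck_on2_const)

lemma Ck_on2_power2: "Ck_on2 k X I g \<Longrightarrow> Ck_on2 k X I (\<lambda>x t. (g x t)\<^sup>2)"
  by (simp add: power2_eq_square Ck_on2_mult)

text \<open>By the chain rule each derivative is a product of the outer derivative composed with
  \<open>g\<close> and a derivative of \<open>g\<close>. The induction therefore varies the outer
  function and uses closure under products.\<close>

lemma Ck_on2_compose:
  "Ck_on k UNIV \<phi> \<Longrightarrow> Ck_on2 k X I g \<Longrightarrow> Ck_on2 k X I (\<lambda>x t. \<phi> (g x t))"
proof (induction k arbitrary: g \<phi>)
  case 0
  have "continuous_on (X \<times> I) (\<phi> \<circ> (\<lambda>(x, t). g x t))"
    using 0 by (intro continuous_on_compose) (auto elim: continuous_on_subset)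
  then show ?case by (simp add: split_def o_def)
next
  case (Suc k)
  note d = Suc.prems(2)[THEN Ck_on2_Suc_imp]
  have \<phi>: "(\<phi> has_real_derivative der UNIV \<phi> y) (at y)" for y
    using Suc.prems(1) by (simp add: der_def vector_derivative_works has_real_derivative_iff_has_vector_derivative)
  have cont: "continuous_on UNIV \<phi>"
    using \<phi> by (meson DERIV_continuous_on has_field_derivative_at_within)
  have x: "((\<lambda>y. \<phi> (g y t)) has_vector_derivative der UNIV \<phi> (g x t) * pd_x X g x t) (at x within X)"
    if "x \<in> X" "t \<in> I" for x t
    using DERIV_chain2[OF \<phi>, of "\<lambda>y. g y t" _ x X] pd_x_has_vector_derivative[OF Suc.prems(2) that]
    by (simp add: has_real_derivative_iff_has_vector_derivative)
  have t: "((\<lambda>s. \<phi> (g x s)) has_vector_derivative der UNIV \<phi> (g x t) * pd_t I g x t) (at t within I)"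
    if "x \<in> X" "t \<in> I" for x t
    using DERIV_chain2[OF \<phi>, of "g x" _ t I] pd_t_has_vector_derivative[OF Suc.prems(2) that]
    by (simp add: has_real_derivative_iff_has_vector_derivative)
  have "continuous_on (X \<times> I) (\<phi> \<circ> (\<lambda>(x, t). g x t))"
    using Suc.prems(2) cont by (intro continuous_on_compose) (auto elim: continuous_on_subset)
  then have c: "continuous_on (X \<times> I) (\<lambda>(x, t). \<phi> (g x t))" by (simp add: split_def o_def)
  show ?case
    using Suc.prems Suc.IH[OF _ d, of "der UNIV \<phi>"]
    by (intro Ck_on2_SucI[OF c x t] Ck_on2_mult) simp_all
qed

text \<open>Lifts the initial datum to the rectangle, so that one-variable regularity follows by
  slicing and the closure rules are needed only for two variables.\<close>

lemma Ck_on2_const_in_t: "Ck_on k X g \<Longrightarrow> Ck_on2 k X I (\<lambda>x t. g x)"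
proof (induction k arbitrary: g)
  case 0
  then show ?case
    by (simp add: split_def continuous_on_compose2[of X g _ fst] continuous_on_fst image_subset_iff)
next
  case (Suc k)
  have g: "(g has_vector_derivative der X g x) (at x within X)" if "x \<in> X" for x
    using Suc.prems that by (simp add: der_def vector_derivative_works)
  then have "continuous_on X g"
    by (auto simp: continuous_on_eq_continuous_within intro: has_vector_derivative_continuous)
  then show ?case
    using Suc.prems Suc.IH[of "der X g"] g
    by (intro Ck_on2_SucI[where gx = "\<lambda>x t. der X g x" and gt = "\<lambda>x t. 0"])
      (simp_all add: split_def Ck_on2_const continuous_on_compose2[of X g _ fst] continuous_on_fst image_subset_iff)
qed

lemma Ck_on2_fst: "Ck_on2 k X I (\<lambda>x t. x)"
proof (cases k)
  case (Suc j)
  show ?thesis unfolding Suc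
    by (rule Ck_on2_SucI[where gx = "\<lambda>x t. 1" and gt = "\<lambda>x t. 0"])
      (simp_all add: split_def Ck_on2_const continuous_on_fst continuous_on_snd has_vector_derivative_id)
qed (simp add: split_def continuous_on_fst continuous_on_snd)

lemma Ck_on2_snd: "Ck_on2 k X I (\<lambda>x t. t)"
proof (cases k)
  case (Suc j)
  show ?thesis unfolding Suc
    by (rule Ck_on2_SucI[where gx = "\<lambda>x t. 0" and gt = "\<lambda>x t. 1"])
      (simp_all add: split_def Ck_on2_const continuous_on_fst continuous_on_snd has_vector_derivative_id)
qed (simp add: split_def continuous_on_fst continuous_on_snd)

section \<open>Regularity of neural networks\<close>

lemma Ck_on2_affine_layer:
  assumes "\<And>j. j < m \<Longrightarrow> Ck_on2 k X I (\<lambda>x t. y x t ! j)" "j < n"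
  shows "Ck_on2 k X I (\<lambda>x t. affine_layer m n p (y x t) ! j)"
  using assms by (auto simp: affine_layer_def intro!: Ck_on2_add Ck_on2_sum Ck_on2_mult Ck_on2_const)

lemma length_affine_layer [simp]: "length (affine_layer m n p y) = n"
  by (simp add: affine_layer_def)

text \<open>The induction peels off the first layer, so the input \<open>y\<close> is an arbitrary
  family with regular components and \<open>p\<close> an arbitrary rest of the parameters. The
  length claim identifies the number of components of the output.\<close>

lemma Ck_on2_network:
  assumes \<sigma>: "Ck_on k UNIV \<sigma>"
    and "ds \<noteq> []" "\<And>x t. length (y x t) = hd ds"
    and "\<And>j. j < hd ds \<Longrightarrow> Ck_on2 k X I (\<lambda>x t. y x t ! j)"
  shows "(\<forall>x t. length (network \<sigma> ds p (y x t)) = last ds) \<and>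
    (\<forall>j<last ds. Ck_on2 k X I (\<lambda>x t. network \<sigma> ds p (y x t) ! j))"
  using assms(2-)
proof (induction ds arbitrary: p y)
  case (Cons m ds)
  \<comment> \<open>The cases follow the recursion of \<open>network\<close>: the last affine layer
    carries no activation.\<close>
  consider "ds = []" | n where "ds = [n]" | n l ds' where "ds = n # l # ds'"
    by (metis list.exhaust)
  then show ?case
  proof cases
    case 1
    with Cons.prems show ?thesis by simp
  next
    case 2
    with Cons.prems show ?thesis by (auto intro!: Ck_on2_affine_layer)
  next
    case 3
    then have net: "network \<sigma> (m # ds) p z =
        network \<sigma> ds (drop (n * (m + 1)) p) (map \<sigma> (affine_layer m n p z))" for z
      by simp
    have last: "last (m # ds) = last ds" and ds: "ds \<noteq> []" and n: "hd ds = n"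
      using 3 by simp_all
    show ?thesis
      unfolding net last
      by (rule Cons.IH[OF ds])
        (use Cons.prems n in \<open>auto intro!: Ck_on2_compose[OF \<sigma>] Ck_on2_affine_layer\<close>)
  qed
qed simp

lemma Ck_on2_net_fun:
  assumes "smooth_activation \<sigma>" "architecture ds"
  shows "Ck_on2 k X I (net_fun \<sigma> ds \<theta>)"
proof -
  have ds: "ds \<noteq> []" "hd ds = 2" "last ds = 1"
    using assms(2) by (auto simp: architecture_def)
  have "Ck_on2 k X I (\<lambda>x t. [x, t] ! j)" if "j < hd ds" for j
  proof -
    from that ds have "j = 0 \<or> j = 1" by auto
    then show ?thesis by (auto simp: Ck_on2_fst Ck_on2_snd)
  qed
  with assms ds have *: "(\<forall>x t. length (network \<sigma> ds \<theta> [x, t]) = 1) \<and>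
      Ck_on2 k X I (\<lambda>x t. network \<sigma> ds \<theta> [x, t] ! 0)"
    using Ck_on2_network[of k \<sigma> ds "\<lambda>x t. [x, t]"] by (simp add: smooth_activation_def)
  have "hd (network \<sigma> ds \<theta> [x, t]) = network \<sigma> ds \<theta> [x, t] ! 0" for x t
    using * by (metis hd_conv_nth length_0_conv one_neq_zero)
  then show ?thesis
    using * by (simp add: net_fun_def[abs_def])
qed

end

lemma Ck_domainI: "a < b \<Longrightarrow> c < d \<Longrightarrow> Ck_domain {a..b} {c..d}"
  by (simp add: Ck_domain_def at_within_Icc_neq_bot)

section \<open>Suprema, slices and regularity of the interior residual\<close>

lemma Ck_on_imp_continuous: "Ck_on k X g \<Longrightarrow> continuous_on X g"
  by (cases k) (auto intro: differentiable_imp_continuous_on simp: differentiable_on_def)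

text \<open>Connects \<open>der UNIV\<close>, in which regularity is expressed, with
  \<open>deriv\<close>, in which the constants of the estimate are expressed.\<close>

lemma Ck_on_UNIV_has_real_derivative:
  assumes "Ck_on (Suc k) UNIV f"
  shows "(f has_real_derivative deriv f s) (at s)" "Ck_on k UNIV (deriv f)"
proof -
  have der: "(f has_real_derivative der UNIV f s) (at s)" for s
    using assms by (simp add: der_def vector_derivative_works has_real_derivative_iff_has_vector_derivative)
  then have eq: "deriv f = der UNIV f"
    by (auto intro: DERIV_imp_deriv)
  show "(f has_real_derivative deriv f s) (at s)" "Ck_on k UNIV (deriv f)"
    unfolding eq using der assms by auto
qed

lemma abs_le_sup_norm:
  assumes "continuous_on {a..b} g" "x \<in> {a..b}"
  shows "\<bar>g x\<bar> \<le> sup_norm {a..b} g"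
proof -
  have "compact ((\<lambda>x. \<bar>g x\<bar>) ` {a..b})"
    using assms by (intro compact_continuous_image continuous_intros compact_Icc)
  then have "bdd_above ((\<lambda>x. \<bar>g x\<bar>) ` {a..b})"
    by (intro bounded_imp_bdd_above compact_imp_bounded)
  then show ?thesis
    unfolding sup_norm_def using assms by (intro cSUP_upper)
qed

text \<open>A real \<open>SUP\<close> is an upper bound only over a bounded set. On the half-open
  rectangle of the solution compactness does not supply this, so boundedness is an explicit
  premise.\<close>

lemma abs_le_sup_norm2:
  assumes "bounded_on2 X I g" "x \<in> X" "t \<in> I"
  shows "\<bar>g x t\<bar> \<le> sup_norm2 X I g"
proof -
  obtain B where "\<And>x t. x \<in> X \<Longrightarrow> t \<in> I \<Longrightarrow> \<bar>g x t\<bar> \<le> B"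
    using assms(1) by (auto simp: bounded_on2_def)
  then have "bdd_above ((\<lambda>(x, t). \<bar>g x t\<bar>) ` (X \<times> I))"
    by (auto simp: bdd_above_def)
  then show ?thesis
    unfolding sup_norm2_def using assms(2,3) cSUP_upper[of "(x, t)" "X \<times> I" "\<lambda>(x, t). \<bar>g x t\<bar>"]
    by simp
qed

lemma continuous_on_imp_bounded_on2:
  assumes "continuous_on ({a..b} \<times> {c..d}) (\<lambda>(x, t). g x t)"
  shows "bounded_on2 {a..b} {c..d} g"
proof -
  have "compact ((\<lambda>(x, t). g x t) ` ({a..b} \<times> {c..d}))"
    using assms by (intro compact_continuous_image compact_Times compact_Icc)
  then obtain B where "\<And>y. y \<in> (\<lambda>(x, t). g x t) ` ({a..b} \<times> {c..d}) \<Longrightarrow> norm y \<le> B"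
    using compact_imp_bounded bounded_iff by metis
  then show ?thesis
    by (force simp: bounded_on2_def)
qed

text \<open>The theorems on parameter integrals expect the parameter, here time, as first
  component.\<close>

lemma continuous_on_swap_args:
  assumes "continuous_on (X \<times> I) (\<lambda>(x, t). g x t)"
  shows "continuous_on (I \<times> X) (\<lambda>(t, x). g x t)"
proof -
  have "continuous_on (I \<times> X) ((\<lambda>(x, t). g x t) \<circ> prod.swap)"
    using assms by (intro continuous_on_compose continuous_on_swap) (simp add: product_swap)
  then show ?thesis by (simp add: o_def split_def)
qed

lemma continuous_on_slices:
  fixes g :: "real \<Rightarrow> real \<Rightarrow> real"
  assumes "continuous_on (X \<times> I) (\<lambda>(x, t). g x t)"
  shows "t \<in> I \<Longrightarrow> continuous_on X (\<lambda>x. g x t)" "x \<in> X \<Longrightarrow> continuous_on I (g x)"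
  using Ck_on_slice_x[of 0 X I g t] Ck_on_slice_t[of 0 X I g x] assms by auto

context Ck_domain
begin

lemma pd_x_compose:
  assumes "Ck_on (Suc k) UNIV f" "Ck_on2 (Suc j) X I g" "x \<in> X" "t \<in> I"
  shows "pd_x X (\<lambda>y s. f (g y s)) x t = deriv f (g x t) * pd_x X g x t"
proof (rule pd_x_eq)
  show "((\<lambda>y. f (g y t)) has_vector_derivative deriv f (g x t) * pd_x X g x t) (at x within X)"
    using DERIV_chain2[OF Ck_on_UNIV_has_real_derivative(1)[OF assms(1)], of "\<lambda>y. g y t" _ x X]
      pd_x_has_vector_derivative[OF assms(2-4)]
    by (simp add: has_real_derivative_iff_has_vector_derivative)
qed fact

end

text \<open>The second space derivative costs two orders; the time derivative and the flux
  derivative cost only one and are weakened to the same class.\<close>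

lemma Ck_on2_R_int:
  assumes "T > 0" "Ck_on (Suc (Suc k)) UNIV f" "Ck_on2 (Suc (Suc k)) {0..1} {0..T} v"
  shows "Ck_on2 k {0..1} {0..T} (R_int \<nu> f T v)"
proof -
  interpret Ck_domain "{0..1}" "{0..T}"
    using assms(1) by (intro Ck_domainI) auto
  have "Ck_on2 (Suc (Suc k)) {0..1} {0..T} (\<lambda>y s. f (v y s))"
    using assms(2,3) by (rule Ck_on2_compose)
  then have "Ck_on2 k {0..1} {0..T} (pd_x {0..1} (\<lambda>y s. f (v y s)))"
    by (rule_tac Ck_on2_Suc_imp) simp
  moreover have "Ck_on2 k {0..1} {0..T} (pd_t {0..T} v)"
    using assms(3) by (rule_tac Ck_on2_Suc_imp) simp
  moreover have "Ck_on2 k {0..1} {0..T} (pd_x {0..1} (pd_x {0..1} v))"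
    using assms(3) by simp
  ultimately have "Ck_on2 k {0..1} {0..T} (\<lambda>x t. pd_t {0..T} v x t + pd_x {0..1} (\<lambda>y s. f (v y s)) x t
       - \<nu> * pd_x {0..1} (pd_x {0..1} v) x t)"
    by (intro Ck_on2_add Ck_on2_diff Ck_on2_mult Ck_on2_const)
  moreover have "R_int \<nu> f T v = (\<lambda>x t. pd_t {0..T} v x t + pd_x {0..1} (\<lambda>y s. f (v y s)) x t
       - \<nu> * pd_x {0..1} (pd_x {0..1} v) x t)"
    by (simp add: R_int_def fun_eq_iff)
  ultimately show ?thesis by simp
qed

section \<open>Stability of the conservation law\<close>

text \<open>Multiply \<open>1 - y \<le> exp (- y)\<close> by \<open>exp y\<close>. It brings the
  Gronwall factor into the form that, times \<open>T\<close>, is the prefactor of the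
  estimate.\<close>

lemma exp_le_one_plus_mult_exp: "exp y \<le> 1 + y * exp (y::real)"
proof -
  have "exp y * (1 - y) \<le> exp y * exp (- y)"
    using exp_ge_add_one_self[of "- y"] by (intro mult_left_mono) auto
  then show ?thesis by (simp add: algebra_simps flip: exp_add)
qed

lemma sqrt_le_of_square_bound:
  assumes "I \<le> e\<^sup>2 + q" "e \<ge> 0" "q \<ge> 0"
  shows "sqrt I \<le> e + sqrt q"
  using order.trans[OF real_sqrt_le_mono[OF assms(1)] sqrt_add_le_add_sqrt[of "e\<^sup>2" q]] assms(2,3)
  by simp

text \<open>The sum of two roots exceeds the root of the sum by a factor of at most
  \<open>sqrt 2\<close>, and \<open>2 / 3 * sqrt 2 < 1\<close>.\<close>

lemma sqrt_sum_two_thirds: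
  assumes "p \<ge> 0" "q \<ge> 0"
  shows "2 / 3 * (sqrt p + sqrt q) \<le> sqrt (p + q)"
proof (rule real_le_rsqrt)
  define X where "X = (sqrt p + sqrt q)\<^sup>2"
  have "X + (sqrt p - sqrt q)\<^sup>2 = 2 * (p + q)"
    using assms by (simp add: X_def power2_sum power2_diff)
  then have X: "X \<le> 2 * (p + q)"
    using zero_le_power2[of "sqrt p - sqrt q"] by linarith
  have "(2 / 3 * (sqrt p + sqrt q))\<^sup>2 = 4 / 9 * X"
    unfolding X_def power_mult_distrib by (simp add: power_divide)
  also have "\<dots> \<le> p + q"
    using X assms by (simp add: field_simps)
  finally show "(2 / 3 * (sqrt p + sqrt q))\<^sup>2 \<le> p + q" .
qed

section \<open>Evolution of the squared error\<close>

text \<open>The inhomogeneity of the Gronwall argument: every term of the energy estimate that does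
  not contain the squared error.\<close>

definition residual_rate ::
  "real \<Rightarrow> (real \<Rightarrow> real) \<Rightarrow> real \<Rightarrow> (real \<Rightarrow> real \<Rightarrow> real) \<Rightarrow> (real \<Rightarrow> real \<Rightarrow> real) \<Rightarrow> real \<Rightarrow> real" where
  "residual_rate \<nu> f T u v t = integral {0..1} (\<lambda>x. (R_int \<nu> f T v x t)\<^sup>2)
     + 2 * f'_norm f T v * ((v 0 t)\<^sup>2 + (v 1 t)\<^sup>2)
     + 2 * \<nu> * C_bdry T u v * (\<bar>v 0 t\<bar> + \<bar>v 1 t\<bar>)"

text \<open>The network enters through its regularity alone. The differentiability order is
  \<open>Suc (Suc k)\<close>, so \<open>k\<close> here is the order left for the interior
  residual.\<close>

locale approximate_solution =
  fixes \<nu> :: real and k :: nat and f ubar :: "real \<Rightarrow> real" and T :: real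
    and u v :: "real \<Rightarrow> real \<Rightarrow> real"
  assumes \<nu>: "\<nu> > 0" and T: "T > 0"
    and f: "Ck_on (Suc (Suc k)) UNIV f"
    and u: "classical_solution \<nu> (Suc (Suc k)) f T ubar u"
    and bounded_u: "bounded_on2 {0..1} {0..<T} u"
    and bounded_ux: "bounded_on2 {0..1} {0..<T} (pd_x {0..1} u)"
    and v: "Ck_on2 (Suc (Suc k)) {0..1} {0..T} v"
begin

sublocale closed: Ck_domain "{0..1}" "{0..T}"
  using T by (intro Ck_domainI) auto

sublocale half_open: Ck_domain "{0..1}" "{0..<T}"
  using T by (simp add: Ck_domain_def at_within_Icc_neq_bot at_within_Ico_neq_bot)

lemma Ck_u: "Ck_on2 (Suc (Suc k)) {0..1} {0..<T} u"
  using u by (simp add: classical_solution_def)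

lemmas f_derivative = Ck_on_UNIV_has_real_derivative(1)[OF f]
lemmas f'_derivative = Ck_on_UNIV_has_real_derivative(1)[OF Ck_on_UNIV_has_real_derivative(2)[OF f]]

lemma continuous_f': "continuous_on S (deriv f)" "continuous_on S (deriv (deriv f))"
  using Ck_on_UNIV_has_real_derivative(2)[OF f] Ck_on_UNIV_has_real_derivative(2)[OF Ck_on_UNIV_has_real_derivative(2)[OF f]]
  by (blast intro: Ck_on_imp_continuous continuous_on_subset)+

lemma Ck_first_derivatives:
  "Ck_on2 (Suc k) {0..1} {0..<T} (pd_x {0..1} u)" "Ck_on2 (Suc k) {0..1} {0..<T} (pd_t {0..<T} u)"
  "Ck_on2 (Suc k) {0..1} {0..T} (pd_x {0..1} v)" "Ck_on2 (Suc k) {0..1} {0..T} (pd_t {0..T} v)"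
  using Ck_u v unfolding Ck_on2.simps(2)[of "Suc k"] by blast+

lemma R_int_continuous: "continuous_on ({0..1} \<times> {0..T}) (\<lambda>(x, t). R_int \<nu> f T v x t)"
  using Ck_on2_R_int[OF T f v] by (rule Ck_on2_imp_continuous)

lemma v_bounds:
  assumes "x \<in> {0..1}" "t \<in> {0..T}"
  shows "\<bar>v x t\<bar> \<le> sup_norm2 {0..1} {0..T} v"
    and "\<bar>pd_x {0..1} v x t\<bar> \<le> sup_norm2 {0..1} {0..T} (pd_x {0..1} v)"
proof -
  have "bounded_on2 {0..1} {0..T} v" "bounded_on2 {0..1} {0..T} (pd_x {0..1} v)"
    using v Ck_first_derivatives(3) by (auto intro!: continuous_on_imp_bounded_on2 elim!: Ck_on2_imp_continuous)
  then show "\<bar>v x t\<bar> \<le> sup_norm2 {0..1} {0..T} v"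
    "\<bar>pd_x {0..1} v x t\<bar> \<le> sup_norm2 {0..1} {0..T} (pd_x {0..1} v)"
    using assms by (auto intro: abs_le_sup_norm2)
qed

lemma u_bounds:
  assumes "x \<in> {0..1}" "t \<in> {0..<T}"
  shows "\<bar>u x t\<bar> \<le> sup_norm2 {0..1} {0..<T} u"
    and "\<bar>pd_x {0..1} u x t\<bar> \<le> sup_norm2 {0..1} {0..<T} (pd_x {0..1} u)"
  using assms bounded_u bounded_ux by (auto intro: abs_le_sup_norm2)

lemma f'_norm_bound: "\<bar>s\<bar> \<le> sup_norm2 {0..1} {0..T} v \<Longrightarrow> \<bar>deriv f s\<bar> \<le> f'_norm f T v"
  unfolding f'_norm_def Let_def by (intro abs_le_sup_norm continuous_f') auto

lemma constants_nonneg: "f'_norm f T v \<ge> 0" "C_bdry T u v \<ge> 0" "C_main f T u v \<ge> 0"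
proof -
  have mem: "0 \<in> {0..1::real}" "0 \<in> {0..T}" "0 \<in> {0..<T}" using T by auto
  have v0: "0 \<le> sup_norm2 {0..1} {0..T} v" "0 \<le> sup_norm2 {0..1} {0..T} (pd_x {0..1} v)"
    using v_bounds[OF mem(1,2)] by linarith+
  have u0: "0 \<le> sup_norm2 {0..1} {0..<T} u" "0 \<le> sup_norm2 {0..1} {0..<T} (pd_x {0..1} u)"
    using u_bounds[OF mem(1,3)] by linarith+
  show "f'_norm f T v \<ge> 0"
    using f'_norm_bound[of 0] v0 by simp
  show "C_bdry T u v \<ge> 0"
    using v0 u0 by (simp add: C_bdry_def)
  define M where "M = max (sup_norm2 {0..1} {0..<T} u) (sup_norm2 {0..1} {0..T} v)"
  have "\<bar>deriv (deriv f) 0\<bar> \<le> sup_norm {-M..M} (deriv (deriv f))"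
    using u0 by (intro abs_le_sup_norm continuous_f') (auto simp: M_def)
  then have "C_fuv f T u v \<ge> 0"
    unfolding C_fuv_def Let_def M_def[symmetric] using u0 by (intro mult_nonneg_nonneg) auto
  then show "C_main f T u v \<ge> 0"
    by (simp add: C_main_def)
qed

text \<open>The scalar estimate at a fixed time. The bound on \<open>f''\<close> runs over the
  common range of \<open>u\<close> and \<open>v\<close>, the bound on \<open>f'\<close> over that of
  \<open>v\<close> alone, as in \<open>C_fuv\<close> and \<open>f'_norm\<close>.\<close>

lemma energy_estimate:
  assumes t: "t \<in> {0..<T}"
  shows "integral {0..1} (\<lambda>x. 2 * (v x t - u x t) * (pd_t {0..T} v x t - pd_t {0..<T} u x t))
    \<le> C_main f T u v * integral {0..1} (\<lambda>x. (v x t - u x t)\<^sup>2) + residual_rate \<nu> f T u v t"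
proof -
  have t': "t \<in> {0..T}" using t by auto
  define M where "M = max (sup_norm2 {0..1} {0..<T} u) (sup_norm2 {0..1} {0..T} v)"
  define P where "P = sup_norm2 {0..1} {0..<T} (pd_x {0..1} u)"
  define L where "L = sup_norm {-M..M} (deriv (deriv f))"
  note d = Ck_first_derivatives
  note conv = has_real_derivative_iff_has_vector_derivative
  have "integral {0..1} (\<lambda>x. 2 * (v x t - u x t) * (pd_t {0..T} v x t - pd_t {0..<T} u x t))
    \<le> integral {0..1} (\<lambda>x. (R_int \<nu> f T v x t)\<^sup>2)
      + (1 + 2 * (L * P)) * integral {0..1} (\<lambda>x. (v x t - u x t)\<^sup>2)
      + 2 * f'_norm f T v * ((v 0 t)\<^sup>2 + (v 1 t)\<^sup>2)
      + 2 * \<nu> * (P + sup_norm2 {0..1} {0..T} (pd_x {0..1} v)) * (\<bar>v 0 t\<bar> + \<bar>v 1 t\<bar>)"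
  proof (rule conservation_law_energy_estimate[OF f_derivative f'_derivative,
        where uxx = "\<lambda>x. pd_x {0..1} (pd_x {0..1} u) x t" and vxx = "\<lambda>x. pd_x {0..1} (pd_x {0..1} v) x t"
          and M = M and m = "sup_norm2 {0..1} {0..T} v"])
    show "((\<lambda>x. u x t) has_real_derivative pd_x {0..1} u x t) (at x within {0..1})"
      "((\<lambda>x. pd_x {0..1} u x t) has_real_derivative pd_x {0..1} (pd_x {0..1} u) x t) (at x within {0..1})"
      "((\<lambda>x. v x t) has_real_derivative pd_x {0..1} v x t) (at x within {0..1})"
      "((\<lambda>x. pd_x {0..1} v x t) has_real_derivative pd_x {0..1} (pd_x {0..1} v) x t) (at x within {0..1})"
      if "x \<in> {0..1}" for x
      unfolding conv using that t t' Ck_u v d by (blast intro: pd_x_has_vector_derivative)+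
    show "continuous_on {0..1} (\<lambda>x. pd_t {0..T} v x t - pd_t {0..<T} u x t)"
      using d(2,4)[THEN Ck_on2_imp_continuous] t t'
      by (intro continuous_on_diff continuous_on_slices)
    show "continuous_on {0..1} (\<lambda>x. R_int \<nu> f T v x t)"
      using R_int_continuous t' by (intro continuous_on_slices)
    show "pd_t {0..T} v x t - pd_t {0..<T} u x t + deriv f (v x t) * pd_x {0..1} v x t
        - deriv f (u x t) * pd_x {0..1} u x t
      = \<nu> * (pd_x {0..1} (pd_x {0..1} v) x t - pd_x {0..1} (pd_x {0..1} u) x t) + R_int \<nu> f T v x t"
      if x: "x \<in> {0<..<1}" for x
    proof -
      have x': "x \<in> {0..1}" using x by auto
      have "pd_t {0..<T} u x t + pd_x {0..1} (\<lambda>y s. f (u y s)) x t = \<nu> * pd_x {0..1} (pd_x {0..1} u) x t"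
        using u x t unfolding classical_solution_def by blast
      then have "pd_t {0..<T} u x t + deriv f (u x t) * pd_x {0..1} u x t = \<nu> * pd_x {0..1} (pd_x {0..1} u) x t"
        unfolding half_open.pd_x_compose[OF f Ck_u x' t] .
      moreover have "R_int \<nu> f T v x t = pd_t {0..T} v x t + deriv f (v x t) * pd_x {0..1} v x t
          - \<nu> * pd_x {0..1} (pd_x {0..1} v) x t"
        using closed.pd_x_compose[OF f v x' t'] by (simp add: R_int_def)
      ultimately show ?thesis by (simp add: algebra_simps)
    qed
    show "u 0 t = 0" "u 1 t = 0"
      using u t by (simp_all add: classical_solution_def)
    show "\<bar>u x t\<bar> \<le> M" "\<bar>v x t\<bar> \<le> M" "\<bar>v x t\<bar> \<le> sup_norm2 {0..1} {0..T} v"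
      "\<bar>pd_x {0..1} u x t\<bar> \<le> P" "\<bar>pd_x {0..1} v x t\<bar> \<le> sup_norm2 {0..1} {0..T} (pd_x {0..1} v)"
      if "x \<in> {0..1}" for x
      using u_bounds[OF that t] v_bounds[OF that t'] t unfolding M_def P_def by auto
    show "\<bar>deriv (deriv f) s\<bar> \<le> L" if "\<bar>s\<bar> \<le> M" for s
      unfolding L_def using that by (intro abs_le_sup_norm continuous_f') auto
  qed (use \<nu> f'_norm_bound in auto)
  then show ?thesis
    unfolding residual_rate_def C_main_def C_fuv_def C_bdry_def Let_def
      M_def[symmetric] P_def[symmetric] L_def[symmetric] by linarith
qed

lemma R_int_sq_integral_continuous:
  "continuous_on {0..T} (\<lambda>t. integral {0..1} (\<lambda>x. (R_int \<nu> f T v x t)\<^sup>2))"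
proof -
  have "continuous_on ({0..T} \<times> cbox 0 1) (\<lambda>(t, x). (R_int \<nu> f T v x t)\<^sup>2)"
    using continuous_on_power[OF continuous_on_swap_args[OF R_int_continuous], of 2] by (simp add: split_def)
  from integral_continuous_on_param[OF this] show ?thesis by simp
qed

lemma v_continuous: "continuous_on ({0..1} \<times> {0..T}) (\<lambda>(x, t). v x t)"
  using v by (rule Ck_on2_imp_continuous)

lemma u_continuous: "continuous_on ({0..1} \<times> {0..<T}) (\<lambda>(x, t). u x t)"
  using Ck_u by (rule Ck_on2_imp_continuous)

lemma v_boundary_continuous: "continuous_on {0..T} (v 0)" "continuous_on {0..T} (v 1)"
  using v_continuous by (auto intro: continuous_on_slices)

text \<open>Differentiation under the integral sign. The time derivative is taken within
  \<open>{0..<T}\<close>, where the derivatives of both functions are jointly continuous.\<close>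

lemma error_has_derivative:
  assumes t: "t \<in> {0..<T}"
  shows "((\<lambda>t. integral {0..1} (\<lambda>x. (v x t - u x t)\<^sup>2)) has_real_derivative
    integral {0..1} (\<lambda>x. 2 * (v x t - u x t) * (pd_t {0..T} v x t - pd_t {0..<T} u x t))) (at t within {0..<T})"
proof -
  note d = Ck_first_derivatives
  have sub: "{0..1} \<times> {0..<T} \<subseteq> {0..1} \<times> {0..T}" by auto
  note c = u_continuous continuous_on_subset[OF v_continuous sub] d(2)[THEN Ck_on2_imp_continuous]
    continuous_on_subset[OF Ck_on2_imp_continuous[OF d(4)] sub]
  have "((\<lambda>t. integral (cbox 0 1) (\<lambda>x. (v x t - u x t)\<^sup>2)) has_real_derivative
    integral (cbox 0 1) (\<lambda>x. 2 * (v x t - u x t) * (pd_t {0..T} v x t - pd_t {0..<T} u x t))) (at t within {0..<T})"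
  proof (rule leibniz_rule_field_derivative[where U = "{0..<T}"])
    fix s and x :: real assume s: "s \<in> {0..<T}" and "x \<in> cbox 0 1"
    then have x: "x \<in> {0..1}" and s': "s \<in> {0..T}" by auto
    have "(v x has_real_derivative pd_t {0..T} v x s) (at s within {0..<T})"
      using pd_t_has_vector_derivative[OF v x s'] unfolding has_real_derivative_iff_has_vector_derivative
      by (rule has_vector_derivative_within_subset) auto
    moreover have "(u x has_real_derivative pd_t {0..<T} u x s) (at s within {0..<T})"
      using pd_t_has_vector_derivative[OF Ck_u x s] by (simp add: has_real_derivative_iff_has_vector_derivative)
    ultimately show "((\<lambda>t. (v x t - u x t)\<^sup>2) has_real_derivative
        2 * (v x s - u x s) * (pd_t {0..T} v x s - pd_t {0..<T} u x s)) (at s within {0..<T})"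
      by (auto intro!: derivative_eq_intros)
  next
    fix s assume s: "s \<in> {0..<T}"
    then have "continuous_on {0..1} (\<lambda>x. (v x s - u x s)\<^sup>2)"
      using c(1,2) by (intro continuous_intros continuous_on_slices)
    then show "(\<lambda>x. (v x s - u x s)\<^sup>2) integrable_on cbox 0 1"
      by (simp add: integrable_continuous_interval)
  next
    show "continuous_on ({0..<T} \<times> cbox 0 1)
        (\<lambda>(s, x). 2 * (v x s - u x s) * (pd_t {0..T} v x s - pd_t {0..<T} u x s))"
      using c[THEN continuous_on_swap_args] unfolding split_def box_real by (intro continuous_intros)
  qed (use t in auto)
  then show ?thesis by simp
qed

text \<open>The initial condition is given only for interior \<open>x\<close>; the two endpoints
  form a negligible set.\<close>

lemma initial_error:
  "integral {0..1} (\<lambda>x. (v x 0 - u x 0)\<^sup>2) = integral {0..1} (\<lambda>x. (R_tb ubar v x)\<^sup>2)"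
proof (rule integral_spike[of "{0, 1}"])
  show "(R_tb ubar v x)\<^sup>2 = (v x 0 - u x 0)\<^sup>2" if "x \<in> {0..1} - {0, 1}" for x
    using that u T by (auto simp: classical_solution_def R_tb_def)
qed auto

text \<open>Gronwall is applied on the closed interval \<open>{0..\<tau>}\<close>, which lies inside
  \<open>{0..<T}\<close>, so the final time is never touched.\<close>

lemma error_bound:
  assumes \<tau>: "\<tau> \<in> {0..<T}"
  shows "integral {0..1} (\<lambda>x. (v x \<tau> - u x \<tau>)\<^sup>2)
    \<le> exp (C_main f T u v * \<tau>) * (integral {0..1} (\<lambda>x. (R_tb ubar v x)\<^sup>2) + integral {0..\<tau>} (residual_rate \<nu> f T u v))"
  unfolding initial_error[symmetric]
proof (rule gronwall_differential)
  fix t assume t: "t \<in> {0..\<tau>}"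
  then have t': "t \<in> {0..<T}" using \<tau> by auto
  show "((\<lambda>t. integral {0..1} (\<lambda>x. (v x t - u x t)\<^sup>2)) has_real_derivative
    integral {0..1} (\<lambda>x. 2 * (v x t - u x t) * (pd_t {0..T} v x t - pd_t {0..<T} u x t))) (at t within {0..\<tau>})"
    using \<tau> by (intro has_field_derivative_subset[OF error_has_derivative[OF t']]) auto
  show "integral {0..1} (\<lambda>x. 2 * (v x t - u x t) * (pd_t {0..T} v x t - pd_t {0..<T} u x t))
    \<le> C_main f T u v * integral {0..1} (\<lambda>x. (v x t - u x t)\<^sup>2) + residual_rate \<nu> f T u v t"
    by (rule energy_estimate[OF t'])
  have "integral {0..1} (\<lambda>x. (R_int \<nu> f T v x t)\<^sup>2) \<ge> 0"
    using R_int_continuous t' by (intro integral_nonneg integrable_continuous_interval continuous_intros continuous_on_slices[of _ "{0..T}"]) auto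
  then show "residual_rate \<nu> f T u v t \<ge> 0"
    unfolding residual_rate_def using constants_nonneg \<nu> by simp
next
  have "continuous_on {0..T} (residual_rate \<nu> f T u v)"
    unfolding residual_rate_def by (intro continuous_intros R_int_sq_integral_continuous v_boundary_continuous)
  then show "residual_rate \<nu> f T u v integrable_on {0..\<tau>}"
    using \<tau> by (intro integrable_continuous_interval) (auto elim: continuous_on_subset)
qed (use \<tau> constants_nonneg in auto)

text \<open>Squared terms are enlarged to the whole time interval. The boundary terms that are
  linear in \<open>v\<close> go through Cauchy-Schwarz on \<open>{0..\<tau>}\<close>, keeping
  \<open>sqrt \<tau>\<close>, whose later integration yields the factor
  \<open>2 / 3\<close>.\<close>

lemma residual_rate_integral_le:
  assumes \<tau>: "\<tau> \<in> {0..T}"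
  shows "integral {0..\<tau>} (residual_rate \<nu> f T u v)
    \<le> integral {0..T} (\<lambda>t. integral {0..1} (\<lambda>x. (R_int \<nu> f T v x t)\<^sup>2))
      + 2 * f'_norm f T v * (integral {0..T} (\<lambda>t. (v 0 t)\<^sup>2) + integral {0..T} (\<lambda>t. (v 1 t)\<^sup>2))
      + 2 * \<nu> * C_bdry T u v * (sqrt \<tau> *
          (sqrt (integral {0..T} (\<lambda>t. (v 0 t)\<^sup>2)) + sqrt (integral {0..T} (\<lambda>t. (v 1 t)\<^sup>2))))"
proof -
  let ?R = "\<lambda>t. integral {0..1} (\<lambda>x. (R_int \<nu> f T v x t)\<^sup>2)"
  have sub: "{0..\<tau>} \<subseteq> {0..T}" using \<tau> by auto
  note c = R_int_sq_integral_continuous v_boundary_continuous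
  note c' = c[THEN continuous_on_subset, OF sub]
  have R_nonneg: "?R t \<ge> 0" if "t \<in> {0..T}" for t
    using continuous_on_slices(1)[OF R_int_continuous that]
    by (intro integral_nonneg integrable_continuous_interval continuous_on_power) auto
  have mono: "integral {0..\<tau>} g \<le> integral {0..T} g"
    if "continuous_on {0..T} g" "\<And>t. t \<in> {0..T} \<Longrightarrow> g t \<ge> 0" for g :: "real \<Rightarrow> real"
    using that sub by (intro integral_subset_le)
      (auto intro!: integrable_continuous_interval elim: continuous_on_subset)
  have root: "integral {0..\<tau>} (\<lambda>t. \<bar>g t\<bar>) \<le> sqrt \<tau> * sqrt (integral {0..T} (\<lambda>t. (g t)\<^sup>2))"
    if g: "continuous_on {0..T} g" for g :: "real \<Rightarrow> real"
  proof -
    have "integral {0..\<tau>} (\<lambda>t. \<bar>g t\<bar>) \<le> sqrt (\<tau> - 0) * sqrt (integral {0..\<tau>} (\<lambda>t. (g t)\<^sup>2))"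
      using \<tau> continuous_on_subset[OF g sub] by (intro integral_abs_le_sqrt_integral_square) auto
    also have "\<dots> \<le> sqrt \<tau> * sqrt (integral {0..T} (\<lambda>t. (g t)\<^sup>2))"
      using \<tau> g by (auto intro!: mult_left_mono mono continuous_on_power)
    finally show ?thesis .
  qed
  have int: "?R integrable_on {0..\<tau>}"
    "(\<lambda>t. (v 0 t)\<^sup>2) integrable_on {0..\<tau>}" "(\<lambda>t. (v 1 t)\<^sup>2) integrable_on {0..\<tau>}"
    "(\<lambda>t. \<bar>v 0 t\<bar>) integrable_on {0..\<tau>}" "(\<lambda>t. \<bar>v 1 t\<bar>) integrable_on {0..\<tau>}"
    by (intro integrable_continuous_interval continuous_intros c')+
  have "(residual_rate \<nu> f T u v has_integral
      integral {0..\<tau>} ?R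
      + 2 * f'_norm f T v * (integral {0..\<tau>} (\<lambda>t. (v 0 t)\<^sup>2) + integral {0..\<tau>} (\<lambda>t. (v 1 t)\<^sup>2))
      + 2 * \<nu> * C_bdry T u v * (integral {0..\<tau>} (\<lambda>t. \<bar>v 0 t\<bar>) + integral {0..\<tau>} (\<lambda>t. \<bar>v 1 t\<bar>))) {0..\<tau>}"
    unfolding residual_rate_def
    by (intro has_integral_add has_integral_mult_right integrable_integral int)
  then have "integral {0..\<tau>} (residual_rate \<nu> f T u v) = integral {0..\<tau>} ?R
      + 2 * f'_norm f T v * (integral {0..\<tau>} (\<lambda>t. (v 0 t)\<^sup>2) + integral {0..\<tau>} (\<lambda>t. (v 1 t)\<^sup>2))
      + 2 * \<nu> * C_bdry T u v * (integral {0..\<tau>} (\<lambda>t. \<bar>v 0 t\<bar>) + integral {0..\<tau>} (\<lambda>t. \<bar>v 1 t\<bar>))"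
    by (rule integral_unique)
  also have "\<dots> \<le> integral {0..T} ?R
      + 2 * f'_norm f T v * (integral {0..T} (\<lambda>t. (v 0 t)\<^sup>2) + integral {0..T} (\<lambda>t. (v 1 t)\<^sup>2))
      + 2 * \<nu> * C_bdry T u v * (sqrt \<tau> * sqrt (integral {0..T} (\<lambda>t. (v 0 t)\<^sup>2))
          + sqrt \<tau> * sqrt (integral {0..T} (\<lambda>t. (v 1 t)\<^sup>2)))"
    using constants_nonneg \<nu> c R_nonneg
    by (intro add_mono mult_left_mono mono root continuous_on_power) auto
  finally show ?thesis by (simp add: distrib_left)
qed

text \<open>
  The factor \<open>2 / 3 = T\<^sup>-\<^sup>3\<^sup>/\<^sup>2 \<integral>\<^sub>0\<^sup>T \<tau>\<^sup>1\<^sup>/\<^sup>2 d\<tau>\<close> is needed to pass from the sum of the two boundary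
  quadrature roots to the root of their sum.
\<close>

lemma gen_error_le:
  "(gen_error T u v)\<^sup>2 \<le> (T + C_main f T u v * T\<^sup>2 * exp (C_main f T u v * T)) *
    (integral {0..1} (\<lambda>x. (R_tb ubar v x)\<^sup>2)
     + integral {0..T} (\<lambda>t. integral {0..1} (\<lambda>x. (R_int \<nu> f T v x t)\<^sup>2))
     + 2 * f'_norm f T v * (integral {0..T} (\<lambda>t. (v 0 t)\<^sup>2) + integral {0..T} (\<lambda>t. (v 1 t)\<^sup>2))
     + 2 * \<nu> * C_bdry T u v * (sqrt T * (2 / 3 *
         (sqrt (integral {0..T} (\<lambda>t. (v 0 t)\<^sup>2)) + sqrt (integral {0..T} (\<lambda>t. (v 1 t)\<^sup>2))))))"
    (is "_ \<le> (T + ?C * T\<^sup>2 * _) * (?tb + ?int + 2 * ?a * (?I0 + ?I1) + _)")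
proof -
  define W where "W t = integral {0..1} (\<lambda>x. \<bar>u x t - v x t\<bar>\<^sup>2)" for t
  define K where "K = 1 + ?C * T * exp (?C * T)"
  define D where "D = ?tb + ?int + 2 * ?a * (?I0 + ?I1)"
  define B where "B = 2 * \<nu> * C_bdry T u v * (sqrt ?I0 + sqrt ?I1)"
  have W_eq: "W t = integral {0..1} (\<lambda>x. (v x t - u x t)\<^sup>2)" for t
    by (simp add: W_def power2_commute[of "u _ t"])
  \<comment> \<open>At \<open>t = T\<close> nothing is known about \<open>u\<close>; if the slice is
    not integrable, the integral has the default value 0.\<close>
  have W_nonneg: "W t \<ge> 0" for t
    unfolding W_def by (cases "(\<lambda>x. \<bar>u x t - v x t\<bar>\<^sup>2) integrable_on {0..1}")
      (auto intro: integral_nonneg simp: not_integrable_integral)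
  have le: "W t \<le> K * (D + B * sqrt t)" if t: "t \<in> {0..<T}" for t
  proof -
    let ?r = "integral {0..t} (residual_rate \<nu> f T u v)"
    have W: "W t \<le> exp (?C * t) * (?tb + ?r)"
      unfolding W_eq by (rule error_bound[OF t])
    \<comment> \<open>Needed to enlarge the exponential factor to \<open>K\<close>; it follows from
      \<open>W t \<ge> 0\<close> because the exponential is positive.\<close>
    have nonneg: "0 \<le> ?tb + ?r"
      using order.trans[OF W_nonneg[of t] W] by (simp add: zero_le_mult_iff)
    have "?tb + ?r \<le> D + B * sqrt t"
      using residual_rate_integral_le[of t] t unfolding D_def B_def by (simp add: ac_simps)
    moreover have "exp (?C * t) \<le> K"
    proof -
      have "exp (?C * t) \<le> exp (?C * T)"
        using t constants_nonneg by (simp add: mult_left_mono)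
      also have "\<dots> \<le> K"
        using exp_le_one_plus_mult_exp[of "?C * T"] by (simp add: K_def)
      finally show ?thesis .
    qed
    moreover from this have "0 \<le> K"
      using exp_ge_zero order.trans by blast
    ultimately show ?thesis
      using nonneg by (intro order.trans[OF W] mult_mono)
  qed
  have K: "T + ?C * T\<^sup>2 * exp (?C * T) = K * T"
    by (simp add: K_def algebra_simps power2_eq_square)
  have bound: "((\<lambda>t. K * (D + B * sqrt t)) has_integral K * (T * D + B * (2 / 3 * T * sqrt T))) {0..T}"
    using T has_integral_const_real[of D 0 T]
    by (intro has_integral_mult_right has_integral_add has_integral_sqrt) auto
  then have bound': "((\<lambda>t. if t \<in> {0..<T} then K * (D + B * sqrt t) else W t)
      has_integral K * (T * D + B * (2 / 3 * T * sqrt T))) {0..T}"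
    by (rule has_integral_spike_finite[of "{T}", rotated 2]) auto
  \<comment> \<open>If \<open>W\<close> were not integrable, its integral would be 0 by convention,
    and nonnegativity of the right-hand side would suffice.\<close>
  have "integral {0..T} W \<le> K * (T * D + B * (2 / 3 * T * sqrt T))"
  proof (cases "W integrable_on {0..T}")
    case True
    show ?thesis
      by (rule has_integral_le[OF integrable_integral[OF True] bound']) (use le in auto)
  next
    case False
    have "0 \<le> K * (T * D + B * (2 / 3 * T * sqrt T))"
      by (rule has_integral_nonneg[OF bound']) (use W_nonneg le order.trans in \<open>auto, blast\<close>)
    then show ?thesis
      by (simp add: not_integrable_integral[OF False])
  qed
  moreover have "(gen_error T u v)\<^sup>2 = integral {0..T} W"
  proof -
    have "integral {0..T} W \<ge> 0"
      by (cases "W integrable_on {0..T}") (auto intro: integral_nonneg W_nonneg simp: not_integrable_integral)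
    then show ?thesis
      unfolding gen_error_def W_def[symmetric] by simp
  qed
  ultimately show ?thesis
    unfolding K D_def[symmetric] by (simp add: B_def algebra_simps)
qed

end

section \<open>The generalization error\<close>

text \<open>Positive weights make the quadrature sum nonnegative, so squaring the training error
  recovers it. The error term is nonnegative because it bounds an absolute value; the sign of
  \<open>C\<close> itself is not prescribed.\<close>

lemma quad_boundD:
  assumes "quad_bound k a b N p w C \<alpha>" "Ck_on k {a..b} (\<lambda>x. (g x)\<^sup>2)"
    and "\<And>n. n \<in> {1..N} \<Longrightarrow> w n > 0"
  shows "integral {a..b} (\<lambda>x. (g x)\<^sup>2) \<le> (sqrt (\<Sum>n=1..N. w n * \<bar>g (p n)\<bar>\<^sup>2))\<^sup>2
      + C (Ck_norm k {a..b} (\<lambda>x. (g x)\<^sup>2)) * real N powr (- \<alpha>)"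
    and "0 \<le> C (Ck_norm k {a..b} (\<lambda>x. (g x)\<^sup>2)) * real N powr (- \<alpha>)"
proof -
  have "\<bar>integral {a..b} (\<lambda>x. (g x)\<^sup>2) - (\<Sum>n=1..N. w n * (g (p n))\<^sup>2)\<bar>
      \<le> C (Ck_norm k {a..b} (\<lambda>x. (g x)\<^sup>2)) * real N powr (- \<alpha>)"
    using assms(1,2) unfolding quad_bound_def by blast
  moreover have "(\<Sum>n=1..N. w n * \<bar>g (p n)\<bar>\<^sup>2) \<ge> 0"
    using assms(3) by (intro sum_nonneg mult_nonneg_nonneg) (auto intro: less_imp_le)
  ultimately show "integral {a..b} (\<lambda>x. (g x)\<^sup>2) \<le> (sqrt (\<Sum>n=1..N. w n * \<bar>g (p n)\<bar>\<^sup>2))\<^sup>2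
      + C (Ck_norm k {a..b} (\<lambda>x. (g x)\<^sup>2)) * real N powr (- \<alpha>)"
    "0 \<le> C (Ck_norm k {a..b} (\<lambda>x. (g x)\<^sup>2)) * real N powr (- \<alpha>)"
    by auto
qed

lemma quad_bound2D:
  assumes "quad_bound2 k T N p q w C \<alpha>" "Ck_on2 k {0..1} {0..T} (\<lambda>x t. (g x t)\<^sup>2)"
    and "\<And>n. n \<in> {1..N} \<Longrightarrow> w n > 0"
  shows "integral {0..T} (\<lambda>t. integral {0..1} (\<lambda>x. (g x t)\<^sup>2))
    \<le> (sqrt (\<Sum>n=1..N. w n * \<bar>g (p n) (q n)\<bar>\<^sup>2))\<^sup>2
      + C (Ck_norm2 k {0..1} {0..T} (\<lambda>x t. (g x t)\<^sup>2)) * real N powr (- \<alpha>)"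
proof -
  have "\<bar>integral {0..T} (\<lambda>t. integral {0..1} (\<lambda>x. (g x t)\<^sup>2)) - (\<Sum>n=1..N. w n * (g (p n) (q n))\<^sup>2)\<bar>
      \<le> C (Ck_norm2 k {0..1} {0..T} (\<lambda>x t. (g x t)\<^sup>2)) * real N powr (- \<alpha>)"
    using assms(1,2) unfolding quad_bound2_def by blast
  moreover have "(\<Sum>n=1..N. w n * \<bar>g (p n) (q n)\<bar>\<^sup>2) \<ge> 0"
    using assms(3) by (intro sum_nonneg mult_nonneg_nonneg) (auto intro: less_imp_le)
  ultimately show ?thesis by auto
qed

theorem theorem4p1:
  shows "\<exists>Cbar_b :: real \<Rightarrow> real \<Rightarrow> real.
    \<forall>(\<nu>::real) (k::nat) (f::real \<Rightarrow> real) (ubar::real \<Rightarrow> real) (T::real) (u::real \<Rightarrow> real \<Rightarrow> real)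
     (\<sigma>::real \<Rightarrow> real) (ds::nat list) (\<Theta>::real list set) (\<theta>::real list) (S::training_set)
     (lam::real) (lam_reg::real) (J_reg::real list \<Rightarrow> real)
     (Cq_tb::real \<Rightarrow> real) (Cq_sb::real \<Rightarrow> real) (Cq_int::real \<Rightarrow> real)
     (\<alpha>_tb::real) (\<alpha>_sb::real) (\<alpha>_int::real).
      \<nu> > 0 \<longrightarrow> k \<ge> 2 \<longrightarrow> T > 0 \<longrightarrow> Ck_on k UNIV f \<longrightarrow> Ck_on k {0..1} ubar \<longrightarrow>
      classical_solution \<nu> k f T ubar u \<longrightarrow>
      bounded_on2 {0..1} {0..<T} u \<longrightarrow> bounded_on2 {0..1} {0..<T} (pd_x {0..1} u) \<longrightarrow>
      smooth_activation \<sigma> \<longrightarrow> architecture ds \<longrightarrow> \<Theta> \<subseteq> {p. length p = num_params ds} \<longrightarrow>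
      valid_training_set T S \<longrightarrow>
      \<alpha>_tb > 0 \<longrightarrow> \<alpha>_sb > 0 \<longrightarrow> \<alpha>_int > 0 \<longrightarrow>
      quad_bound k 0 1 (N_tb S) (x_tb S) (w_tb S) Cq_tb \<alpha>_tb \<longrightarrow>
      quad_bound k 0 T (N_sb S) (t_sb S) (w_sb S) Cq_sb \<alpha>_sb \<longrightarrow>
      quad_bound2 (k - 2) T (N_int S) (x_int S) (t_int S) (w_int S) Cq_int \<alpha>_int \<longrightarrow>
      lam > 0 \<longrightarrow> lam_reg \<ge> 0 \<longrightarrow>
      pinn_output \<nu> f T ubar S \<sigma> ds \<Theta> lam lam_reg J_reg \<theta> \<longrightarrow>
      (let v = net_fun \<sigma> ds \<theta>;
           C = C_main f T u v;
           C_b = C_bdry T u v;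
           Cb = Cbar_b (f'_norm f T v) (sup_norm2 {0..1} {0..T} v);
           Ctb = Cq_tb (Ck_norm k {0..1} (\<lambda>x. (R_tb ubar v x)\<^sup>2));
           Cint = Cq_int (Ck_norm2 (k - 2) {0..1} {0..T} (\<lambda>x t. (R_int \<nu> f T v x t)\<^sup>2));
           Csb = (\<lambda>i. Cq_sb (Ck_norm k {0..T} (\<lambda>t. (R_sb i v t)\<^sup>2)))
       in (gen_error T u v)\<^sup>2
          \<le> (T + C * T\<^sup>2 * exp (C * T)) *
              ((E_tb ubar S v)\<^sup>2 + (E_int \<nu> f T S v)\<^sup>2
               + 2 * Cb * ((E_sb 0 S v)\<^sup>2 + (E_sb 1 S v)\<^sup>2)
               + 2 * \<nu> * C_b * T powr (1/2) * (E_sb 0 S v + E_sb 1 S v))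
            + (T + C * T\<^sup>2 * exp (C * T)) *
              (Ctb * real (N_tb S) powr (- \<alpha>_tb) + Cint * real (N_int S) powr (- \<alpha>_int)
               + 2 * Cb * (Csb 0 + Csb 1) * real (N_sb S) powr (- \<alpha>_sb)
               + 2 * \<nu> * C_b * T powr (1/2) * (Csb 0 + Csb 1) powr (1/2)
                   * real (N_sb S) powr (- \<alpha>_sb / 2)))"
\<comment> \<open>The witness returns its first argument, which is \<open>f'_norm f T v\<close>; it
  is fixed before all data, so the constant depends only on the two indicated quantities.\<close>
proof (rule exI[of _ "\<lambda>a b. a"], intro allI impI, goal_cases)
  case (1 \<nu> k f ubar T u \<sigma> ds \<Theta> \<theta> S lam lam_reg J_reg Cq_tb Cq_sb Cq_int \<alpha>_tb \<alpha>_sb \<alpha>_int)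
  note asm = 1
  define v where "v = net_fun \<sigma> ds \<theta>"
  obtain j where k: "k = Suc (Suc j)"
    using \<open>2 \<le> k\<close> by (metis Suc_le_D numeral_2_eq_2 Suc_le_mono)
  have dom: "Ck_domain {0..1} {0..T}"
    using \<open>0 < T\<close> by (intro Ck_domainI) auto
  have Ck_v: "Ck_on2 k {0..1} {0..T} v"
    unfolding v_def using asm by (intro Ck_domain.Ck_on2_net_fun[OF dom])
  interpret approximate_solution \<nu> j f ubar T u v
    using asm Ck_v unfolding k by unfold_locales
  have wpos: "\<And>n. n \<in> {1..N_tb S} \<Longrightarrow> w_tb S n > 0" "\<And>n. n \<in> {1..N_sb S} \<Longrightarrow> w_sb S n > 0"
    "\<And>n. n \<in> {1..N_int S} \<Longrightarrow> w_int S n > 0"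
    using \<open>valid_training_set T S\<close> by (auto simp: valid_training_set_def)
  define a where "a = f'_norm f T v"
  define C where "C = C_main f T u v"
  define C_b where "C_b = C_bdry T u v"
  define qtb where "qtb = Cq_tb (Ck_norm k {0..1} (\<lambda>x. (R_tb ubar v x)\<^sup>2)) * real (N_tb S) powr (- \<alpha>_tb)"
  define qint where "qint = Cq_int (Ck_norm2 (k - 2) {0..1} {0..T} (\<lambda>x t. (R_int \<nu> f T v x t)\<^sup>2))
    * real (N_int S) powr (- \<alpha>_int)"
  define Csb where "Csb i = Cq_sb (Ck_norm k {0..T} (\<lambda>t. (R_sb i v t)\<^sup>2))" for i
  define q where "q i = Csb i * real (N_sb S) powr (- \<alpha>_sb)" for i
  define I where "I i = integral {0..T} (\<lambda>t. (R_sb i v t)\<^sup>2)" for i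
  have N: "real (N_sb S) > 0"
    using \<open>valid_training_set T S\<close> by (simp add: valid_training_set_def)
  have "Ck_on2 k {0..1} {0..T} (\<lambda>x t. (v x t - ubar x)\<^sup>2)"
    using Ck_v \<open>Ck_on k {0..1} ubar\<close>
    by (intro closed.Ck_on2_power2 closed.Ck_on2_diff closed.Ck_on2_const_in_t)
  from Ck_on_slice_x[OF this, of 0] have "Ck_on k {0..1} (\<lambda>x. (R_tb ubar v x)\<^sup>2)"
    using T by (simp add: R_tb_def)
  note tb = quad_boundD(1)[OF \<open>quad_bound k 0 1 _ _ _ _ _\<close> this wpos(1),
      folded E_tb_def qtb_def]
  have "Ck_on2 (k - 2) {0..1} {0..T} (\<lambda>x t. (R_int \<nu> f T v x t)\<^sup>2)"
    using Ck_on2_R_int[OF T f v] by (simp add: k closed.Ck_on2_power2)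
  note int = quad_bound2D[OF \<open>quad_bound2 _ _ _ _ _ _ _ _\<close> this wpos(3), folded E_int_def qint_def]
  \<comment> \<open>The condition \<open>i \<le> 1\<close> keeps the boundary point
    \<open>real i\<close> inside the space interval.\<close>
  have sb: "I i \<le> (E_sb i S v)\<^sup>2 + q i" "q i \<ge> 0" if "i \<le> 1" for i
  proof -
    have "Ck_on k {0..T} (\<lambda>t. (R_sb i v t)\<^sup>2)"
      unfolding R_sb_def
      using Ck_on_slice_t[OF closed.Ck_on2_power2[OF Ck_v], of "real i"] that by simp
    note quad_boundD[OF \<open>quad_bound k 0 T _ _ _ _ _\<close> this wpos(2), folded E_sb_def I_def, folded Csb_def, folded q_def]
    then show "I i \<le> (E_sb i S v)\<^sup>2 + q i" "q i \<ge> 0" by simp_all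
  qed
  have E_sb: "E_sb i S v \<ge> 0" for i
    unfolding E_sb_def using wpos(2)
    by (intro real_sqrt_ge_zero sum_nonneg mult_nonneg_nonneg) (auto intro: less_imp_le)
  \<comment> \<open>The factor \<open>2 / 3\<close> is given away on the training errors, which are
    nonnegative, and spent on merging the two quadrature roots.\<close>
  have roots: "2 / 3 * (sqrt (I 0) + sqrt (I 1)) \<le> E_sb 0 S v + E_sb 1 S v + sqrt (q 0 + q 1)"
  proof -
    have "2 / 3 * (sqrt (I 0) + sqrt (I 1))
        \<le> 2 / 3 * ((E_sb 0 S v + sqrt (q 0)) + (E_sb 1 S v + sqrt (q 1)))"
      using sb E_sb by (intro mult_left_mono add_mono sqrt_le_of_square_bound) auto
    also have "\<dots> \<le> E_sb 0 S v + E_sb 1 S v + sqrt (q 0 + q 1)"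
      using sqrt_sum_two_thirds[of "q 0" "q 1"] sb(2)[of 0] sb(2)[of 1] E_sb[of 0] E_sb[of 1] by simp
    finally show ?thesis .
  qed
  \<comment> \<open>Identifying \<open>powr (1/2)\<close> with \<open>sqrt\<close> requires a
    nonnegative base. The sign of \<open>Csb i\<close> is recovered from \<open>q i \<ge> 0\<close>,
    since the power of the positive number of points is positive.\<close>
  have sqrt_q: "sqrt (q 0 + q 1) = (Csb 0 + Csb 1) powr (1/2) * real (N_sb S) powr (- \<alpha>_sb / 2)"
  proof -
    have "Csb i \<ge> 0" if "i \<le> 1" for i
      using sb(2)[OF that] N by (simp add: q_def zero_le_mult_iff)
    then have "Csb 0 + Csb 1 \<ge> 0" by simp
    then show ?thesis
      using N by (simp add: q_def powr_half_sqrt real_sqrt_mult powr_powr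
          flip: distrib_right powr_half_sqrt_powr)
  qed
  have "(gen_error T u v)\<^sup>2 \<le> (T + C * T\<^sup>2 * exp (C * T)) *
      (integral {0..1} (\<lambda>x. (R_tb ubar v x)\<^sup>2)
       + integral {0..T} (\<lambda>t. integral {0..1} (\<lambda>x. (R_int \<nu> f T v x t)\<^sup>2))
       + 2 * a * (I 0 + I 1) + 2 * \<nu> * C_b * (sqrt T * (2 / 3 * (sqrt (I 0) + sqrt (I 1)))))"
    using gen_error_le by (simp add: I_def R_sb_def a_def C_def C_b_def)
  also have "\<dots> \<le> (T + C * T\<^sup>2 * exp (C * T)) *
      (((E_tb ubar S v)\<^sup>2 + qtb) + ((E_int \<nu> f T S v)\<^sup>2 + qint)
       + 2 * a * (((E_sb 0 S v)\<^sup>2 + q 0) + ((E_sb 1 S v)\<^sup>2 + q 1))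
       + 2 * \<nu> * C_b * (sqrt T * (E_sb 0 S v + E_sb 1 S v + sqrt (q 0 + q 1))))"
    using constants_nonneg T \<nu> roots tb int sb(1)
    by (intro mult_left_mono add_mono) (auto simp: a_def C_def C_b_def)
  also have "\<dots> = (T + C * T\<^sup>2 * exp (C * T)) *
      ((E_tb ubar S v)\<^sup>2 + (E_int \<nu> f T S v)\<^sup>2 + 2 * a * ((E_sb 0 S v)\<^sup>2 + (E_sb 1 S v)\<^sup>2)
        + 2 * \<nu> * C_b * T powr (1/2) * (E_sb 0 S v + E_sb 1 S v))
     + (T + C * T\<^sup>2 * exp (C * T)) *
      (qtb + qint + 2 * a * (Csb 0 + Csb 1) * real (N_sb S) powr (- \<alpha>_sb)
        + 2 * \<nu> * C_b * T powr (1/2) * (Csb 0 + Csb 1) powr (1/2) * real (N_sb S) powr (- \<alpha>_sb / 2))"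
    unfolding sqrt_q using T by (simp add: q_def powr_half_sqrt algebra_simps)
  finally show ?case
    unfolding Let_def v_def[symmetric] a_def C_def C_b_def qtb_def qint_def Csb_def .
qed

end
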